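(* Every $R\in\mathcal C_{K_0}$ can be written as $R=X^\dagger X$ with $X=\bigoplus_k(I_{\mathcal H_k}\otimes X_k)\in\mathcal A'_G$. Let $S=\{k:X_k\neq0\}$ and let $P_k$ be the orthogonal projector onto $\mathcal H_k\otimes\mathbb C^{m_k}$. Then $R$ is extremal in $\mathcal C_{K_0}$ if and only if the map $O\mapsto\operatorname{Tr}_{\mathcal K}[X^\dagger OX]$ is injective on $\mathcal A'_G\cap\mathcal B(\operatorname{Rng}(X))$, i.e. $$O\in\mathcal A'_G\cap\mathcal B(\operatorname{Rng}(X)),\ \operatorname{Tr}_{\mathcal K}[X^\dagger OX]=0\ \Longrightarrow\ O=0,$$ and this is equivalent to the surjectivity of the linear map $$\mathcal B(\mathcal H)\ni C\ \longmapsto\ \bigoplus_{k\in S}X_k\operatorname{Tr}_{\mathcal H_k}\big[P_k(I_{\mathcal K}\otimes C)P_k\big]X_k^\dagger\ \in\ \bigoplus_{k\in S}\mathcal B(\operatorname{Rng}(X_k)).$$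
   Context: Let $\mathcal H,\mathcal K$ be finite-dimensional Hilbert spaces and $g\mapsto U_g$, $g\mapsto V_g$ unitary representations of a group $G$ on $\mathcal H$ and $\mathcal K$. $U_g^*$ is the complex conjugate in a fixed orthonormal basis. Decompose $\mathcal K\otimes\mathcal H=\bigoplus_k(\mathcal H_k\otimes\mathbb C^{m_k})$ according to the equivalence classes $k$ of irreducible components of $V_g\otimes U_g^*$ (irreducible space $\mathcal H_k$, multiplicity $m_k$). The commutant $\mathcal A'_G$ of $\{V_g\otimes U_g^*\}$ consists of the operators $\bigoplus_k(I_{\mathcal H_k}\otimes M_k)$, $M_k\in\mathcal B(\mathbb C^{m_k})$. Fix $K_0$ on $\mathcal H$ with $0\le K_0\le I_{\mathcal H}$ and let $\mathcal C_{K_0}=\{R\in\mathcal A'_G: R\ge0,\ \operatorname{Tr}_{\mathcal K}[R]=K_0\}$ (operator forms of $G$-covariant quantum operations $\mathcal M$ with $\mathcal M(I_{\mathcal K})=K_0$). $\operatorname{Tr}_{\mathcal H_k}$ denotes the partial trace $\mathcal B(\mathcal H_k\otimes\mathbb C^{m_k})\to\mathcal B(\mathbb C^{m_k})$, with $P_k(\cdot)P_k$ regarded as an operator on $\mathcal H_k\otimes\mathbb C^{m_k}$. $\mathcal B(\operatorname{Rng}(X))$ denotes operators whose support and range lie in $\operatorname{Rng}(X)$. Extremal means not a proper convex combination of two distinct elements of $\mathcal C_{K_0}$. *)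

theory Defs
  imports "Jordan_Normal_Form.Matrix" "HOL-Algebra.Group"
begin

(* Conventions: a d-dimensional Hilbert space is C^d with its standard (fixed) orthonormal
   basis; operators are complex matrices (Jordan_Normal_Form).  The tensor product
   C^a (x) C^b is C^(a*b) with basis index (i,j) |-> i*b + j. *)

definition adj :: "complex mat \<Rightarrow> complex mat" where
  "adj A = mat (dim_col A) (dim_row A) (\<lambda>(i,j). cnj (A $$ (j,i)))"

definition cconj :: "complex mat \<Rightarrow> complex mat" where
  "cconj A = mat (dim_row A) (dim_col A) (\<lambda>(i,j). cnj (A $$ (i,j)))"

definition kron :: "complex mat \<Rightarrow> complex mat \<Rightarrow> complex mat" where
  "kron A B = mat (dim_row A * dim_row B) (dim_col A * dim_col B)
     (\<lambda>(i,j). A $$ (i div dim_row B, j div dim_col B) * B $$ (i mod dim_row B, j mod dim_col B))"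

definition ptrace1 :: "nat \<Rightarrow> nat \<Rightarrow> complex mat \<Rightarrow> complex mat" where
  "ptrace1 a b A = mat b b (\<lambda>(i,j). \<Sum>r<a. A $$ (r*b + i, r*b + j))"

definition unitary_mat :: "nat \<Rightarrow> complex mat \<Rightarrow> bool" where
  "unitary_mat n A \<longleftrightarrow> A \<in> carrier_mat n n \<and> adj A * A = 1\<^sub>m n \<and> A * adj A = 1\<^sub>m n"

definition psd :: "nat \<Rightarrow> complex mat \<Rightarrow> bool" where
  "psd n A \<longleftrightarrow> A \<in> carrier_mat n n \<and> adj A = A \<and>
     (\<forall>v \<in> carrier_vec n. 0 \<le> conjugate v \<bullet> (A *\<^sub>v v))"

definition unitary_rep :: "('g, 'b) monoid_scheme \<Rightarrow> nat \<Rightarrow> ('g \<Rightarrow> complex mat) \<Rightarrow> bool" where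
  "unitary_rep G d \<rho> \<longleftrightarrow>
     (\<forall>g \<in> carrier G. unitary_mat d (\<rho> g)) \<and>
     (\<forall>g \<in> carrier G. \<forall>h \<in> carrier G. \<rho> (g \<otimes>\<^bsub>G\<^esub> h) = \<rho> g * \<rho> h)"

definition lin_subspace :: "nat \<Rightarrow> complex vec set \<Rightarrow> bool" where
  "lin_subspace d W \<longleftrightarrow> W \<subseteq> carrier_vec d \<and> 0\<^sub>v d \<in> W \<and>
     (\<forall>v \<in> W. \<forall>w \<in> W. v + w \<in> W) \<and> (\<forall>c. \<forall>v \<in> W. c \<cdot>\<^sub>v v \<in> W)"

definition irreducible_rep :: "('g, 'b) monoid_scheme \<Rightarrow> nat \<Rightarrow> ('g \<Rightarrow> complex mat) \<Rightarrow> bool" where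
  "irreducible_rep G d \<rho> \<longleftrightarrow> unitary_rep G d \<rho> \<and> d \<noteq> 0 \<and>
     (\<forall>W. lin_subspace d W \<and> (\<forall>g \<in> carrier G. \<forall>w \<in> W. \<rho> g *\<^sub>v w \<in> W)
          \<longrightarrow> W = {0\<^sub>v d} \<or> W = carrier_vec d)"

definition equivalent_reps ::
  "('g, 'b) monoid_scheme \<Rightarrow> nat \<Rightarrow> ('g \<Rightarrow> complex mat) \<Rightarrow> nat \<Rightarrow> ('g \<Rightarrow> complex mat) \<Rightarrow> bool" where
  "equivalent_reps G d1 \<rho>1 d2 \<rho>2 \<longleftrightarrow> d1 = d2 \<and>
     (\<exists>T \<in> carrier_mat d1 d1. invertible_mat T \<and> (\<forall>g \<in> carrier G. T * \<rho>1 g = \<rho>2 g * T))"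

definition msum :: "nat \<Rightarrow> nat \<Rightarrow> (nat \<Rightarrow> complex mat) \<Rightarrow> complex mat" where
  "msum n N F = mat n n (\<lambda>(i,j). \<Sum>k<N. F k $$ (i,j))"

(* Isotypic decomposition of a unitary representation \<rho> on C^n:
     C^n = (+)_{k<N} J k (C^(d k) (x) C^(m k)),
   J k an isometry onto the k-th isotypic block, on which \<rho> acts as \<pi> k (x) I_(m k),
   the \<pi> k being pairwise inequivalent irreducible representations. *)
definition isotypic_decomp ::
  "('g, 'b) monoid_scheme \<Rightarrow> nat \<Rightarrow> ('g \<Rightarrow> complex mat) \<Rightarrow> nat \<Rightarrow> (nat \<Rightarrow> nat) \<Rightarrow> (nat \<Rightarrow> nat)
    \<Rightarrow> (nat \<Rightarrow> 'g \<Rightarrow> complex mat) \<Rightarrow> (nat \<Rightarrow> complex mat) \<Rightarrow> bool" where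
  "isotypic_decomp G n \<rho> N d m \<pi> J \<longleftrightarrow>
     (\<forall>k<N. irreducible_rep G (d k) (\<pi> k) \<and> m k \<noteq> 0 \<and>
            J k \<in> carrier_mat n (d k * m k) \<and> adj (J k) * J k = 1\<^sub>m (d k * m k) \<and>
            (\<forall>g \<in> carrier G. \<rho> g * J k = J k * kron (\<pi> k g) (1\<^sub>m (m k)))) \<and>
     (\<forall>k<N. \<forall>l<N. k \<noteq> l \<longrightarrow> adj (J k) * J l = 0\<^sub>m (d k * m k) (d l * m l) \<and>
                             \<not> equivalent_reps G (d k) (\<pi> k) (d l) (\<pi> l)) \<and>
     msum n N (\<lambda>k. J k * adj (J k)) = 1\<^sub>m n"

definition blockop :: "nat \<Rightarrow> nat \<Rightarrow> (nat \<Rightarrow> nat) \<Rightarrow> (nat \<Rightarrow> complex mat) \<Rightarrow> (nat \<Rightarrow> complex mat)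
    \<Rightarrow> complex mat" where
  "blockop n N d J M = msum n N (\<lambda>k. J k * kron (1\<^sub>m (d k)) (M k) * adj (J k))"

definition commutant :: "('g, 'b) monoid_scheme \<Rightarrow> nat \<Rightarrow> ('g \<Rightarrow> complex mat) \<Rightarrow> complex mat set" where
  "commutant G n \<rho> = {A \<in> carrier_mat n n. \<forall>g \<in> carrier G. A * \<rho> g = \<rho> g * A}"

definition rng :: "complex mat \<Rightarrow> complex vec set" where
  "rng X = {X *\<^sub>v v | v. v \<in> carrier_vec (dim_col X)}"

(* B(S) for a subspace S of C^n: operators whose range and support lie in S *)
definition ops_on :: "nat \<Rightarrow> complex vec set \<Rightarrow> complex mat set" where
  "ops_on n S = {B \<in> carrier_mat n n. rng B \<subseteq> S \<and> rng (adj B) \<subseteq> S}"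

definition CK0 :: "('g, 'b) monoid_scheme \<Rightarrow> nat \<Rightarrow> nat \<Rightarrow> ('g \<Rightarrow> complex mat) \<Rightarrow> ('g \<Rightarrow> complex mat)
    \<Rightarrow> complex mat \<Rightarrow> complex mat set" where
  "CK0 G dK dH V U K0 = {R. R \<in> commutant G (dK * dH) (\<lambda>g. kron (V g) (cconj (U g))) \<and>
      psd (dK * dH) R \<and> ptrace1 dK dH R = K0}"

definition extremal_in :: "complex mat set \<Rightarrow> complex mat \<Rightarrow> bool" where
  "extremal_in C R \<longleftrightarrow> R \<in> C \<and>
     (\<forall>R1 \<in> C. \<forall>R2 \<in> C. \<forall>t::real. 0 < t \<and> t < 1 \<and>
        R = complex_of_real t \<cdot>\<^sub>m R1 + complex_of_real (1 - t) \<cdot>\<^sub>m R2 \<longrightarrow> R1 = R2)"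

end

theory Submission
  imports Defs "Jordan_Normal_Form.Spectral_Radius"
begin

text \<open>By Schur's lemma the commutant consists of the operators \<open>\<Oplus>\<^sub>k (I \<otimes> M\<^sub>k)\<close>, so that a positive
  element factors as \<open>X\<^sup>\<dagger> X\<close> block by block (Cholesky). If \<open>R = X\<^sup>\<dagger> X\<close> is a proper convex combination of
  \<open>R\<^sub>1\<close> and \<open>R\<^sub>2\<close>, then \<open>R\<^sub>1 - R\<^sub>2\<close> vanishes on the kernel of \<open>X\<close> and hence equals \<open>X\<^sup>\<dagger> O X\<close> for some
  \<open>O\<close> in the commutant living on the range of \<open>X\<close>; conversely a hermitian such \<open>O\<close> with
  \<open>Tr\<^sub>K[X\<^sup>\<dagger> O X] = 0\<close> gives the feasible perturbations \<open>X\<^sup>\<dagger> (I \<plusminus> s O) X\<close>. Finally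
  \<open>Tr(C Tr\<^sub>K[X\<^sup>\<dagger> O X]) = \<Sum>\<^sub>k Tr(L(C)\<^sub>k O\<^sub>k)\<close>, where \<open>L\<close> is the map of the surjectivity condition:
  the two linear maps are dual to each other, so one is injective iff the other is surjective.\<close>

section \<open>Matrices, partial traces and projectors\<close>

text \<open>The factor X is arbitrary and need not be invertible, while every operator built from it
  has to stay in the commutant. Its range is therefore handled by a matrix \<open>Z\<close> for
  which \<open>X * Z\<close> is the orthogonal projector onto it: membership in B(Rng X) becomes a
  pair of absorption equations, and choosing \<open>Z\<close> block by block puts both
  \<open>bop Z\<close> and the projector into the commutant. A second such matrix, for the adjoint
  of X, gives the projector onto the support. Perturbations inside the convex set are hermitian, so
  extremality says something about hermitian O only; the general case follows because the kernel in
  question is closed under adjoints. Surjectivity is obtained without counting dimensions: a target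
  is projected onto the image of the map by least squares, and the residual, being orthogonal to the
  image, gives an element of the kernel of the dual map. The same least-squares lemma supplies the
  range projectors.\<close>

lemma sum_lessThan_mult:
  fixes h :: "nat \<Rightarrow> 'a::comm_monoid_add"
  shows "(\<Sum>i<a * b. h i) = (\<Sum>i<a. \<Sum>j<b. h (i * b + j))"
proof -
  have "sum h {i * b..<i * b + b} = (\<Sum>j<b. h (i * b + j))" for i
    using sum.shift_bounds_nat_ivl[of h 0 "i * b" b] by (simp add: atLeast0LessThan add.commute)
  then show ?thesis using sum.nat_group[of h b a] by simp
qed

lemma mat_mult_index:
  assumes "A \<in> carrier_mat p n" "B \<in> carrier_mat n q" "i < p" "j < q"
  shows "(A * B) $$ (i,j) = (\<Sum>l<n. A $$ (i,l) * B $$ (l,j))"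
  using assms by (auto simp: scalar_prod_def atLeast0LessThan)

lemma mat_mult3_index:
  assumes "A \<in> carrier_mat p n" "B \<in> carrier_mat n q" "C \<in> carrier_mat q r" "i < p" "j < r"
  shows "(A * B * C) $$ (i,j) = (\<Sum>l<n. \<Sum>k<q. A $$ (i,l) * B $$ (l,k) * C $$ (k,j))"
proof -
  have "(A * B * C) $$ (i,j) = (\<Sum>k<q. (A * B) $$ (i,k) * C $$ (k,j))"
    using assms by (intro mat_mult_index) auto
  also have "\<dots> = (\<Sum>k<q. \<Sum>l<n. A $$ (i,l) * B $$ (l,k) * C $$ (k,j))"
    using assms by (simp add: mat_mult_index[of A p n B q] sum_distrib_right del: index_mult_mat)
  finally show ?thesis by (subst sum.swap)
qed

lemma adj_carrier [simp, intro]: "A \<in> carrier_mat p q \<Longrightarrow> adj A \<in> carrier_mat q p"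
  by (auto simp: adj_def)

lemma adj_dim [simp]: "dim_row (adj A) = dim_col A" "dim_col (adj A) = dim_row A"
  by (auto simp: adj_def)

lemma adj_index [simp]: "i < dim_col A \<Longrightarrow> j < dim_row A \<Longrightarrow> adj A $$ (i,j) = cnj (A $$ (j,i))"
  by (auto simp: adj_def)

lemma adj_adj [simp]: "adj (adj A) = A"
  by (rule eq_matI) auto

lemma adj_mult:
  assumes "A \<in> carrier_mat p n" "B \<in> carrier_mat n q"
  shows "adj (A * B) = adj B * adj A"
  using assms by (intro eq_matI) (auto simp: scalar_prod_def intro!: sum.cong)

lemma adj_add: "A \<in> carrier_mat p q \<Longrightarrow> B \<in> carrier_mat p q \<Longrightarrow> adj (A + B) = adj A + adj B"
  by (intro eq_matI) auto

lemma adj_minus: "A \<in> carrier_mat p q \<Longrightarrow> B \<in> carrier_mat p q \<Longrightarrow> adj (A - B) = adj A - adj B"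
  by (intro eq_matI) auto

lemma adj_smult: "adj (c \<cdot>\<^sub>m A) = cnj c \<cdot>\<^sub>m adj A"
  by (intro eq_matI) auto

lemma adj_one [simp]: "adj (1\<^sub>m n) = 1\<^sub>m n"
  by (intro eq_matI) auto

lemma adj_zero [simp]: "adj (0\<^sub>m p q) = 0\<^sub>m q p"
  by (intro eq_matI) auto

section \<open>Kronecker products\<close>

lemma kron_carrier [simp, intro]:
  "A \<in> carrier_mat p q \<Longrightarrow> B \<in> carrier_mat r s \<Longrightarrow> kron A B \<in> carrier_mat (p * r) (q * s)"
  by (auto simp: kron_def)

lemma div_mod_less_mult:
  fixes i a b :: nat
  assumes "i < a * b"
  shows "i div b < a" "i mod b < b"
proof -
  have "b > 0" using assms by (cases b) auto
  then show "i mod b < b" by simp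
  show "i div b < a" using assms by (simp add: less_mult_imp_div_less)
qed

lemma mult_add_less_mult:
  fixes i j a b :: nat
  assumes "i < a" "j < b"
  shows "i * b + j < a * b"
proof -
  have "i * b + j < (i + 1) * b" using assms by simp
  also have "\<dots> \<le> a * b" using assms by (intro mult_le_mono1) simp
  finally show ?thesis .
qed

lemma kron_index:
  assumes "A \<in> carrier_mat p q" "B \<in> carrier_mat r s" "i < p * r" "j < q * s"
  shows "kron A B $$ (i,j) = A $$ (i div r, j div s) * B $$ (i mod r, j mod s)"
  using assms by (auto simp: kron_def)

lemma kron_mult:
  assumes "A \<in> carrier_mat p q" "B \<in> carrier_mat r s"
    and "C \<in> carrier_mat q t" "D \<in> carrier_mat s u"
  shows "kron A B * kron C D = kron (A * C) (B * D)"
proof (rule eq_matI)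
  fix i j assume "i < dim_row (kron (A * C) (B * D))" "j < dim_col (kron (A * C) (B * D))"
  then have ij: "i < p * r" "j < t * u" using assms by (auto simp: kron_def)
  note b = div_mod_less_mult[OF ij(1)] div_mod_less_mult[OF ij(2)]
  have "(kron A B * kron C D) $$ (i,j) = (\<Sum>l<q * s. kron A B $$ (i,l) * kron C D $$ (l,j))"
    using assms ij by (intro mat_mult_index) auto
  also have "\<dots> = (\<Sum>x<q. \<Sum>y<s. kron A B $$ (i,x * s + y) * kron C D $$ (x * s + y,j))"
    by (rule sum_lessThan_mult)
  also have "\<dots> = (\<Sum>x<q. \<Sum>y<s. (A $$ (i div r, x) * C $$ (x, j div u)) *
      (B $$ (i mod r, y) * D $$ (y, j mod u)))"
    using assms ij mult_add_less_mult by (intro sum.cong refl) (simp add: kron_index)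
  also have "\<dots> = (A * C) $$ (i div r, j div u) * (B * D) $$ (i mod r, j mod u)"
    using assms b by (simp add: mat_mult_index[of A p q C t] mat_mult_index[of B r s D u]
        sum_product del: index_mult_mat)
  also have "\<dots> = kron (A * C) (B * D) $$ (i,j)"
    using assms ij by (subst kron_index[of _ p t _ r u]) auto
  finally show "(kron A B * kron C D) $$ (i,j) = kron (A * C) (B * D) $$ (i,j)" .
qed (use assms in \<open>auto simp: kron_def\<close>)

lemma adj_kron: "adj (kron A B) = kron (adj A) (adj B)"
  by (rule eq_matI) (auto simp: kron_def div_mod_less_mult)

text \<open>The upper left \<open>m\<close> by \<open>m\<close> corner of
  \<open>kron (1\<^sub>m d) A\<close> is \<open>A\<close>; the corner exists because
  \<open>d\<close> is nonzero.\<close>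

lemma kron_one_inject:
  assumes "kron (1\<^sub>m d) A = kron (1\<^sub>m d) B" "A \<in> carrier_mat m m" "B \<in> carrier_mat m m" "d \<noteq> 0"
  shows "A = B"
proof (rule eq_matI)
  fix i j assume "i < dim_row B" "j < dim_col B"
  then have ij: "i < m" "j < m" using assms by auto
  then have b: "i < d * m" "j < d * m" using assms(4)
    by (metis add_0 less_nat_zero_code mult_0 mult_add_less_mult neq0_conv)+
  have "C $$ (i,j) = kron (1\<^sub>m d) C $$ (i,j)" if "C \<in> carrier_mat m m" for C :: "complex mat"
    using assms(4) ij b that by (subst kron_index[of _ d d _ m m]) auto
  then show "A $$ (i,j) = B $$ (i,j)" using assms by metis
qed (use assms in auto)

section \<open>Traces and partial traces\<close>

definition mtrace :: "complex mat \<Rightarrow> complex" where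
  "mtrace A = (\<Sum>i<dim_row A. A $$ (i,i))"

lemma mtrace_mult:
  assumes "A \<in> carrier_mat p q" "B \<in> carrier_mat q p"
  shows "mtrace (A * B) = (\<Sum>i<p. \<Sum>j<q. A $$ (i,j) * B $$ (j,i))"
  using assms by (simp add: mtrace_def mat_mult_index[of A p q B p] del: index_mult_mat(1))

lemma mtrace_comm:
  assumes "A \<in> carrier_mat p q" "B \<in> carrier_mat q p"
  shows "mtrace (A * B) = mtrace (B * A)"
  unfolding mtrace_mult[OF assms] mtrace_mult[OF assms(2,1)]
  by (subst sum.swap) (simp add: mult.commute)

text \<open>This is the squared Hilbert-Schmidt norm. Its definiteness is the means by which
  matrices are shown to vanish from trace identities.\<close>

lemma mtrace_adj_mult:
  assumes "A \<in> carrier_mat p q"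
  shows "mtrace (adj A * A) = of_real (\<Sum>j<q. \<Sum>i<p. (cmod (A $$ (i,j)))\<^sup>2)"
proof -
  have "mtrace (adj A * A) = (\<Sum>j<q. \<Sum>i<p. cnj (A $$ (i,j)) * A $$ (i,j))"
    using assms by (subst mtrace_mult[of _ q p]) auto
  then show ?thesis unfolding of_real_sum complex_norm_square by (simp add: mult.commute)
qed

lemma mtrace_adj_mult_eq_0_iff:
  assumes "A \<in> carrier_mat p q"
  shows "mtrace (adj A * A) = 0 \<longleftrightarrow> A = 0\<^sub>m p q"
proof
  assume "mtrace (adj A * A) = 0"
  then have "(\<Sum>j<q. \<Sum>i<p. (cmod (A $$ (i,j)))\<^sup>2) = 0"
    unfolding mtrace_adj_mult[OF assms] of_real_eq_0_iff .
  then have "\<forall>j<q. \<forall>i<p. A $$ (i,j) = 0"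
    by (simp add: sum_nonneg_eq_0_iff sum_nonneg)
  then show "A = 0\<^sub>m p q" using assms by (intro eq_matI) auto
next
  assume "A = 0\<^sub>m p q"
  then show "mtrace (adj A * A) = 0" by (simp add: mtrace_def)
qed

lemma mtrace_add:
  assumes "A \<in> carrier_mat p p" "B \<in> carrier_mat p p"
  shows "mtrace (A + B) = mtrace A + mtrace B"
  using assms by (simp add: mtrace_def sum.distrib)

lemma mtrace_smult: "A \<in> carrier_mat p p \<Longrightarrow> mtrace (c \<cdot>\<^sub>m A) = c * mtrace A"
  by (simp add: mtrace_def sum_distrib_left)

text \<open>For the trace pairing the partial trace is dual to the embedding of C as I tensor C. The
  identity serves both for the trace over K and for the traces over the irreducible spaces.\<close>

lemma mtrace_ptrace1:
  assumes A: "A \<in> carrier_mat (a * b) (a * b)" and C: "C \<in> carrier_mat b b"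
  shows "mtrace (C * ptrace1 a b A) = mtrace (kron (1\<^sub>m a) C * A)"
proof -
  have P: "ptrace1 a b A \<in> carrier_mat b b" by (simp add: ptrace1_def)
  have "mtrace (kron (1\<^sub>m a) C * A) = (\<Sum>i<a*b. \<Sum>j<a*b. kron (1\<^sub>m a) C $$ (i,j) * A $$ (j,i))"
    using assms by (intro mtrace_mult) auto
  also have "\<dots> = (\<Sum>x<a. \<Sum>i<b. \<Sum>y<a. \<Sum>j<b. kron (1\<^sub>m a) C $$ (x*b+i,y*b+j) * A $$ (y*b+j,x*b+i))"
    unfolding sum_lessThan_mult ..
  also have "\<dots> = (\<Sum>x<a. \<Sum>i<b. \<Sum>y<a. if y = x then \<Sum>j<b. C $$ (i,j) * A $$ (x*b+j,x*b+i) else 0)"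
    using C mult_add_less_mult by (intro sum.cong refl) (auto simp: kron_index[of _ a a _ b b])
  also have "\<dots> = (\<Sum>x<a. \<Sum>i<b. \<Sum>j<b. C $$ (i,j) * A $$ (x*b+j,x*b+i))"
    by (simp add: sum.delta)
  also have "\<dots> = (\<Sum>i<b. \<Sum>j<b. \<Sum>x<a. C $$ (i,j) * A $$ (x*b+j,x*b+i))"
    by (subst sum.swap, rule sum.cong[OF refl], subst sum.swap, rule refl)
  also have "\<dots> = mtrace (C * ptrace1 a b A)"
    unfolding mtrace_mult[OF C P] by (auto simp: ptrace1_def sum_distrib_left intro!: sum.cong)
  finally show ?thesis by simp
qed

lemma ptrace1_carrier [simp, intro]: "ptrace1 a b A \<in> carrier_mat b b"
  by (simp add: ptrace1_def)

lemma ptrace1_add: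
  assumes "A \<in> carrier_mat (a * b) (a * b)" "B \<in> carrier_mat (a * b) (a * b)"
  shows "ptrace1 a b (A + B) = ptrace1 a b A + ptrace1 a b B"
  using assms
  by (intro eq_matI) (simp_all add: ptrace1_def mult_add_less_mult sum.distrib)

lemma ptrace1_smult:
  assumes "A \<in> carrier_mat (a * b) (a * b)"
  shows "ptrace1 a b (c \<cdot>\<^sub>m A) = c \<cdot>\<^sub>m ptrace1 a b A"
  using assms
  by (intro eq_matI) (simp_all add: ptrace1_def mult_add_less_mult sum_distrib_left)

lemma ptrace1_adj:
  assumes "A \<in> carrier_mat (a * b) (a * b)"
  shows "ptrace1 a b (adj A) = adj (ptrace1 a b A)"
  using assms
  by (intro eq_matI) (simp_all add: ptrace1_def mult_add_less_mult)

text \<open>Gram--Schmidt on the family \<open>L\<close>, one vector at a time.\<close>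

lemma least_squares:
  fixes L :: "'j \<Rightarrow> 'i \<Rightarrow> complex" and y :: "'i \<Rightarrow> complex"
  assumes "finite J"
  shows "\<exists>c. \<forall>j\<in>J. (\<Sum>i\<in>I. cnj (y i - (\<Sum>l\<in>J. c l * L l i)) * L j i) = 0"
  using assms
proof (induction J arbitrary: y rule: finite_induct)
  case empty
  then show ?case by simp
next
  case (insert a J)
  from insert.IH[of "L a"] obtain c' where
    c': "\<forall>j\<in>J. (\<Sum>i\<in>I. cnj (L a i - (\<Sum>l\<in>J. c' l * L l i)) * L j i) = 0" by auto
  from insert.IH[of y] obtain c where
    c: "\<forall>j\<in>J. (\<Sum>i\<in>I. cnj (y i - (\<Sum>l\<in>J. c l * L l i)) * L j i) = 0" by auto
  \<comment> \<open>\<open>e'\<close> is the part of \<open>L a\<close> orthogonal to the earlier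
    vectors and \<open>e\<close> the residual of \<open>y\<close>. Below, \<open>t\<close> is the
    coefficient of \<open>e\<close> along \<open>e'\<close>, conjugated because the pairing is
    conjugate linear in its first argument.\<close>
  define e' where "e' i = L a i - (\<Sum>l\<in>J. c' l * L l i)" for i
  define e where "e i = y i - (\<Sum>l\<in>J. c l * L l i)" for i
  define s where "s = (\<Sum>i\<in>I. cnj (e' i) * e' i)"
  define t where "t = cnj ((\<Sum>i\<in>I. cnj (e i) * e' i) / s)"
  have orth: "(\<Sum>i\<in>I. cnj (f i) * L a i) = (\<Sum>i\<in>I. cnj (f i) * e' i)"
    if "\<And>j. j \<in> J \<Longrightarrow> (\<Sum>i\<in>I. cnj (f i) * L j i) = 0" for f :: "'i \<Rightarrow> complex"
  proof -
    have "(\<Sum>i\<in>I. cnj (f i) * e' i) =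
        (\<Sum>i\<in>I. cnj (f i) * L a i) - (\<Sum>i\<in>I. \<Sum>l\<in>J. c' l * (cnj (f i) * L l i))"
      by (simp add: e'_def algebra_simps sum_subtractf sum_distrib_left)
    also have "(\<Sum>i\<in>I. \<Sum>l\<in>J. c' l * (cnj (f i) * L l i)) =
        (\<Sum>l\<in>J. c' l * (\<Sum>i\<in>I. cnj (f i) * L l i))"
      by (subst sum.swap) (simp add: sum_distrib_left)
    also have "\<dots> = 0" using that by simp
    finally show ?thesis by simp
  qed
  define g where "g i = e i - t * e' i" for i
  have gJ: "(\<Sum>i\<in>I. cnj (g i) * L j i) = 0" if "j \<in> J" for j
  proof -
    have "(\<Sum>i\<in>I. cnj (g i) * L j i) =
        (\<Sum>i\<in>I. cnj (e i) * L j i) - cnj t * (\<Sum>i\<in>I. cnj (e' i) * L j i)"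
      by (simp add: g_def algebra_simps sum_subtractf sum_distrib_left)
    then show ?thesis using c c' that by (simp add: e_def e'_def)
  qed
  have ga: "(\<Sum>i\<in>I. cnj (g i) * L a i) = 0"
  proof (cases "s = 0")
    case True
    \<comment> \<open>Here \<open>L a\<close> depends on the earlier vectors: \<open>e'\<close>
      vanishes on a finite \<open>I\<close>, and over an infinite \<open>I\<close> every sum is 0 by
      convention.\<close>
    show ?thesis
    proof (cases "finite I")
      case fin: True
      have "s = of_real (\<Sum>i\<in>I. (cmod (e' i))\<^sup>2)"
        unfolding of_real_sum complex_norm_square by (simp add: s_def mult.commute)
      then have "(\<Sum>i\<in>I. (cmod (e' i))\<^sup>2) = 0" using True by (metis of_real_eq_0_iff)
      then have "\<forall>i\<in>I. e' i = 0" using fin by (simp add: sum_nonneg_eq_0_iff)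
      then show ?thesis by (subst orth) (auto simp: gJ)
    qed simp
  next
    case False
    have "(\<Sum>i\<in>I. cnj (g i) * L a i) = (\<Sum>i\<in>I. cnj (e i) * e' i) - cnj t * s"
      by (subst orth[OF gJ], assumption) (simp add: g_def s_def algebra_simps sum_subtractf sum_distrib_left)
    then show ?thesis using False by (simp add: t_def)
  qed
  \<comment> \<open>Expanding \<open>e'\<close> in \<open>g i = e i - t * e' i\<close> gives
    \<open>L a\<close> the coefficient \<open>t\<close> and shifts the old coefficients by
    \<open>- t * c' l\<close>.\<close>
  define c'' where "c'' l = (if l = a then t else c l - t * c' l)" for l
  have "y i - (\<Sum>l\<in>insert a J. c'' l * L l i) = g i" for i
  proof -
    have "(\<Sum>l\<in>J. c'' l * L l i) = (\<Sum>l\<in>J. c l * L l i - t * (c' l * L l i))"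
      using insert.hyps by (intro sum.cong) (auto simp: c''_def algebra_simps)
    then have "(\<Sum>l\<in>insert a J. c'' l * L l i) =
        t * L a i + ((\<Sum>l\<in>J. c l * L l i) - t * (\<Sum>l\<in>J. c' l * L l i))"
      using insert.hyps by (simp add: c''_def sum_subtractf sum_distrib_left)
    then show ?thesis by (simp add: g_def e_def e'_def algebra_simps)
  qed
  then show ?case using gJ ga by (intro exI[of _ c'']) auto
qed

text \<open>The columns of \<open>Z\<close> are least-squares solutions, so that \<open>X\<^sup>\<dagger> X Z = X\<^sup>\<dagger>\<close>; the rest is algebra.\<close>

lemma range_projector:
  assumes X: "X \<in> carrier_mat n m"
  shows "\<exists>Z\<in>carrier_mat m n. adj (X * Z) = X * Z \<and> X * Z * X = X"
proof -
  define y :: "nat \<Rightarrow> nat \<Rightarrow> complex" where "y q i = (if i = q then 1 else 0)" for q i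
  have "\<forall>q. \<exists>c. \<forall>j\<in>{..<m}. (\<Sum>i<n. cnj (y q i - (\<Sum>l<m. c l * X $$ (i,l))) * X $$ (i,j)) = 0"
    by (intro allI least_squares) simp
  then obtain c where
    c: "\<And>q j. j < m \<Longrightarrow> (\<Sum>i<n. cnj (y q i - (\<Sum>l<m. c q l * X $$ (i,l))) * X $$ (i,j)) = 0"
    unfolding choice_iff by blast
  define Z where "Z = mat m n (\<lambda>(l,q). c q l)"
  have Z: "Z \<in> carrier_mat m n" by (simp add: Z_def)
  have XZ: "X * Z \<in> carrier_mat n n" using X Z by simp
  then have E: "adj (1\<^sub>m n - X * Z) \<in> carrier_mat n n" by (intro adj_carrier minus_carrier_mat)
  have "adj (1\<^sub>m n - X * Z) * X = 0\<^sub>m n m"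
  proof (rule eq_matI)
    fix q j assume "q < dim_row (0\<^sub>m n m :: complex mat)" "j < dim_col (0\<^sub>m n m :: complex mat)"
    then have qj: "q < n" "j < m" by auto
    have "(adj (1\<^sub>m n - X * Z) * X) $$ (q,j) = (\<Sum>i<n. adj (1\<^sub>m n - X * Z) $$ (q,i) * X $$ (i,j))"
      by (rule mat_mult_index[OF E X qj])
    also have "\<dots> = (\<Sum>i<n. cnj (y q i - (\<Sum>l<m. c q l * X $$ (i,l))) * X $$ (i,j))"
    proof (intro sum.cong refl)
      fix i assume "i \<in> {..<n}"
      then have i: "i < n" by simp
      have "(X * Z) $$ (i,q) = (\<Sum>l<m. X $$ (i,l) * Z $$ (l,q))"
        using qj i X Z by (intro mat_mult_index) auto
      also have "\<dots> = (\<Sum>l<m. c q l * X $$ (i,l))"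
        using qj by (intro sum.cong refl) (simp add: Z_def mult.commute)
      finally show "adj (1\<^sub>m n - X * Z) $$ (q,i) * X $$ (i,j)
          = cnj (y q i - (\<Sum>l<m. c q l * X $$ (i,l))) * X $$ (i,j)"
        using qj i X Z by (simp add: y_def del: index_mult_mat(1))
    qed
    also have "\<dots> = 0" using c qj by simp
    finally show "(adj (1\<^sub>m n - X * Z) * X) $$ (q,j) = 0\<^sub>m n m $$ (q,j)" using qj by simp
  qed (use X Z in auto)
  moreover have "adj (1\<^sub>m n - X * Z) * X = X - adj (X * Z) * X"
    using X XZ by (simp add: adj_minus[of _ n n] minus_mult_distrib_mat[of _ n n])
  ultimately have eq: "X - adj (X * Z) * X = 0\<^sub>m n m" by simp
  have PX: "adj (X * Z) * X = X"
  proof (rule eq_matI)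
    fix i j assume "i < dim_row X" "j < dim_col X"
    then show "(adj (X * Z) * X) $$ (i,j) = X $$ (i,j)"
      using arg_cong[OF eq, of "\<lambda>M. M $$ (i,j)"] X Z XZ by (simp del: index_mult_mat(1))
  qed (use X Z in auto)
  \<comment> \<open>The left side is hermitian whatever \<open>X * Z\<close> is, hence so is the
    right side.\<close>
  have "adj (X * Z) * (X * Z) = X * Z"
    using PX X Z assoc_mult_mat[OF adj_carrier[OF XZ] X Z] by simp
  moreover have "adj (adj (X * Z) * (X * Z)) = adj (X * Z) * (X * Z)"
    using XZ by (simp add: adj_mult[of _ n n])
  ultimately have "adj (X * Z) = X * Z" by simp
  then show ?thesis using PX Z by auto
qed

lemma mat_eq_of_mult_vec:
  fixes A B :: "'a::comm_semiring_1 mat"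
  assumes "A \<in> carrier_mat p q" "B \<in> carrier_mat p q"
    and "\<And>v. v \<in> carrier_vec q \<Longrightarrow> A *\<^sub>v v = B *\<^sub>v v"
  shows "A = B"
proof (rule eq_matI)
  fix i j assume "i < dim_row B" "j < dim_col B"
  then show "A $$ (i,j) = B $$ (i,j)"
    using assms(1,2) arg_cong[OF assms(3)[of "unit_vec q j"], of "\<lambda>v. v $ i"] by simp
qed (use assms in auto)

text \<open>\<open>X * Z\<close> is the orthogonal projector onto the range of \<open>X\<close>. It
  absorbs on the left exactly the operators with range in \<open>rng X\<close>; taking adjoints
  turns the condition on the support into absorption on the right.\<close>

lemma ops_on_rng_iff:
  assumes X: "X \<in> carrier_mat n m" and Z: "Z \<in> carrier_mat m n"
    and P: "adj (X * Z) = X * Z" "X * Z * X = X"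
  shows "B \<in> ops_on n (rng X) \<longleftrightarrow> B \<in> carrier_mat n n \<and> X * Z * B = B \<and> B * (X * Z) = B"
proof -
  have XZ: "X * Z \<in> carrier_mat n n" using X Z by simp
  have key: "rng C \<subseteq> rng X \<longleftrightarrow> X * Z * C = C" if C: "C \<in> carrier_mat n n" for C
  proof
    assume sub: "rng C \<subseteq> rng X"
    show "X * Z * C = C"
    proof (rule mat_eq_of_mult_vec)
      fix v :: "complex vec" assume v: "v \<in> carrier_vec n"
      then have "C *\<^sub>v v \<in> rng X" using sub C unfolding rng_def by auto
      then obtain w where w: "C *\<^sub>v v = X *\<^sub>v w" "w \<in> carrier_vec m"
        using X unfolding rng_def by auto
      have "X * Z * C *\<^sub>v v = X * Z *\<^sub>v (C *\<^sub>v v)"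
        using v C XZ by (simp add: assoc_mult_mat_vec[of _ n n _ n])
      also have "\<dots> = X * Z * X *\<^sub>v w"
        unfolding w(1) using w(2) X XZ by (simp add: assoc_mult_mat_vec[of _ n n _ m])
      finally show "X * Z * C *\<^sub>v v = C *\<^sub>v v" using P w by simp
    qed (use C XZ in auto)
  next
    assume eq: "X * Z * C = C"
    show "rng C \<subseteq> rng X"
    proof
      fix x assume "x \<in> rng C"
      then obtain v where v: "x = C *\<^sub>v v" "v \<in> carrier_vec n"
        using C unfolding rng_def by auto
      have "X *\<^sub>v ((Z * C) *\<^sub>v v) = (X * (Z * C)) *\<^sub>v v"
        using X Z C v by (subst assoc_mult_mat_vec[of _ n m _ n]) auto
      also have "X * (Z * C) = C" using eq X Z C by (subst assoc_mult_mat[symmetric]) auto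
      finally have "x = X *\<^sub>v ((Z * C) *\<^sub>v v)" using v by simp
      moreover have "(Z * C) *\<^sub>v v \<in> carrier_vec (dim_col X)" using X Z C v by auto
      ultimately show "x \<in> rng X" unfolding rng_def by auto
    qed
  qed
  have "X * Z * adj B = adj B \<longleftrightarrow> B * (X * Z) = B" if B: "B \<in> carrier_mat n n"
  proof -
    have "adj (X * Z * adj B) = B * (X * Z)"
      using XZ B by (subst adj_mult[of _ n n _ n]) (auto simp: P)
    then show ?thesis by (metis adj_adj)
  qed
  then show ?thesis unfolding ops_on_def using key by auto
qed

section \<open>Positive semidefinite matrices: Cholesky factors and compressions\<close>

lemma mult_vec_index:
  assumes "A \<in> carrier_mat p n" "v \<in> carrier_vec n" "i < p"
  shows "(A *\<^sub>v v) $ i = (\<Sum>j<n. A $$ (i,j) * v $ j)"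
  using assms by (auto simp: scalar_prod_def atLeast0LessThan)

lemma quadratic_form_sum:
  assumes "A \<in> carrier_mat n n" "v \<in> carrier_vec n"
  shows "conjugate v \<bullet> (A *\<^sub>v v) = (\<Sum>i<n. \<Sum>j<n. cnj (v $ i) * A $$ (i,j) * v $ j)"
  using assms
  by (simp add: scalar_prod_def mult_vec_index[of A n n] atLeast0LessThan sum_distrib_left
      mult.assoc del: index_mult_mat_vec)

text \<open>Induction on the size, eliminating the last row and column: the Schur complement
  \<open>B\<close> of the last diagonal entry is again positive, and its factor is bordered by one
  more row. Entries are functions on the naturals, so that passing from \<open>Suc n\<close> to
  \<open>n\<close> involves no submatrices.\<close>

lemma cholesky:
  fixes A :: "nat \<Rightarrow> nat \<Rightarrow> complex"
  assumes "\<And>i j. i < n \<Longrightarrow> j < n \<Longrightarrow> A j i = cnj (A i j)"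
    and "\<And>v. 0 \<le> (\<Sum>i<n. \<Sum>j<n. cnj (v i) * A i j * v j)"
  shows "\<exists>X. \<forall>i<n. \<forall>j<n. A i j = (\<Sum>k<n. cnj (X k i) * X k j)"
  using assms
proof (induction n arbitrary: A)
  case 0
  then show ?case by simp
next
  case (Suc n)
  define a where "a = A n n"
  have split: "(\<Sum>i<Suc n. \<Sum>j<Suc n. cnj (v i) * A i j * v j) =
      (\<Sum>i<n. \<Sum>j<n. cnj (v i) * A i j * v j) + cnj (\<Sum>j<n. A n j * v j) * v n
        + cnj (v n) * (\<Sum>j<n. A n j * v j) + cnj (v n) * a * v n" for v
  proof -
    have "(\<Sum>i<n. cnj (v i) * A i n * v n) = cnj (\<Sum>j<n. A n j * v j) * v n"
      unfolding cnj_sum sum_distrib_right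
    proof (intro sum.cong refl)
      fix i assume "i \<in> {..<n}"
      then show "cnj (v i) * A i n * v n = cnj (A n i * v i) * v n"
        using Suc.prems(1)[of n i] by simp
    qed
    then show ?thesis
      by (simp add: sum.distrib a_def sum_distrib_left algebra_simps)
  qed
  have "0 \<le> (\<Sum>i<Suc n. \<Sum>j<Suc n. cnj (if i = n then 1 else 0) * A i j * (if j = n then 1 else 0))"
    by (rule Suc.prems(2))
  then have a0: "0 \<le> a" unfolding split by simp
  then have a_real: "a = of_real (Re a)" "Re a \<ge> 0"
    by (auto simp: less_eq_complex_def complex_eq_iff)
  have zero: "A n j = 0" if a: "a = 0" and j: "j < Suc n" for j
  proof (rule ccontr)
    assume z: "A n j \<noteq> 0"
    with a have jn: "j < n" using j by (auto simp: a_def less_Suc_eq)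
    \<comment> \<open>With this \<open>r\<close> the form at \<open>v\<close> has real part
      \<open>Re (A j j) - 2 * (Re (A j j) + 1)\<close>, which is negative because
      \<open>A j j\<close> is nonnegative.\<close>
    define r where "r = (Re (A j j) + 1) / (cmod (A n j))\<^sup>2"
    define v where "v i = (if i = j then 1 else if i = n then - of_real r * A n j else 0)" for i
    have vn: "v n = - of_real r * A n j" using jn by (simp add: v_def)
    have s1: "(\<Sum>l<n. A n l * v l) = A n j"
    proof -
      have "(\<Sum>l<n. A n l * v l) = (\<Sum>l<n. if l = j then A n j else 0)"
        by (intro sum.cong) (auto simp: v_def)
      then show ?thesis using jn by simp
    qed
    have s2: "(\<Sum>i<n. \<Sum>l<n. cnj (v i) * A i l * v l) = A j j"
    proof -
      have "(\<Sum>i<n. \<Sum>l<n. cnj (v i) * A i l * v l)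
          = (\<Sum>i<n. \<Sum>l<n. if l = j then if i = j then A j j else 0 else 0)"
        by (intro sum.cong) (auto simp: v_def)
      then show ?thesis using jn by simp
    qed
    have "0 \<le> A j j + cnj (A n j) * (- of_real r * A n j)
        + cnj (- of_real r * A n j) * A n j + cnj (- of_real r * A n j) * a * (- of_real r * A n j)"
      using Suc.prems(2)[of v] unfolding split s1 s2 vn .
    also have "\<dots> = A j j - 2 * of_real (r * (cmod (A n j))\<^sup>2)"
      using a complex_norm_square[of "A n j"] by (simp add: algebra_simps flip: of_real_power)
    also have "r * (cmod (A n j))\<^sup>2 = Re (A j j) + 1" using z by (simp add: r_def)
    finally have "0 \<le> Re (A j j) - 2 * (Re (A j j) + 1)" by (simp add: less_eq_complex_def)
    moreover have "0 \<le> A j j"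
    proof -
      have "(\<Sum>i<Suc n. \<Sum>l<Suc n. cnj (if i = j then 1 else 0) * A i l * (if l = j then 1 else 0))
         = (\<Sum>i<Suc n. \<Sum>l<Suc n. if l = j then if i = j then A j j else 0 else 0)"
        by (intro sum.cong) auto
      also have "\<dots> = A j j" using jn by (simp del: sum.lessThan_Suc)
      finally show ?thesis using Suc.prems(2)[of "\<lambda>i. if i = j then 1 else 0"] by simp
    qed
    ultimately show False by (simp add: less_eq_complex_def)
  qed
  \<comment> \<open>For a zero pivot, division by zero makes \<open>B\<close> equal to
    \<open>A\<close>.\<close>
  define B where "B i j = A i j - A i n * A n j / a" for i j
  have "\<exists>X. \<forall>i<n. \<forall>j<n. B i j = (\<Sum>k<n. cnj (X k i) * X k j)"
  proof (rule Suc.IH)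
    fix i j assume "i < n" "j < n"
    then have "A j i = cnj (A i j)" "A j n = cnj (A n j)" "A n i = cnj (A i n)"
      using Suc.prems(1)[of i j] Suc.prems(1)[of n j] Suc.prems(1)[of i n] by auto
    moreover have "cnj a = a" using a_real by (metis complex_cnj_complex_of_real)
    ultimately show "B j i = cnj (B i j)" by (simp add: B_def mult.commute)
  next
    fix v :: "nat \<Rightarrow> complex"
    define s where "s = (\<Sum>j<n. A n j * v j)"
    \<comment> \<open>The last coordinate completes the square: the form of \<open>A\<close> at
      \<open>w\<close> equals the form of \<open>B\<close> at \<open>v\<close>. For
      \<open>a = 0\<close> this coordinate is 0.\<close>
    define w where "w i = (if i = n then - s / a else v i)" for i
    have cs: "cnj s = (\<Sum>i<n. cnj (v i) * A i n)"
      unfolding s_def cnj_sum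
    proof (intro sum.cong refl)
      fix i assume "i \<in> {..<n}"
      then show "cnj (A n i * v i) = cnj (v i) * A i n" using Suc.prems(1)[of n i] by simp
    qed
    have "(\<Sum>i<n. \<Sum>j<n. cnj (v i) * B i j * v j) =
        (\<Sum>i<n. \<Sum>j<n. cnj (v i) * A i j * v j) - (\<Sum>i<n. \<Sum>j<n. cnj (v i) * A i n * (A n j * v j)) / a"
      by (simp add: B_def algebra_simps sum_subtractf sum_divide_distrib)
    also have "(\<Sum>i<n. \<Sum>j<n. cnj (v i) * A i n * (A n j * v j)) = cnj s * s"
      unfolding cs unfolding s_def sum_product ..
    finally have Bv: "(\<Sum>i<n. \<Sum>j<n. cnj (v i) * B i j * v j) =
        (\<Sum>i<n. \<Sum>j<n. cnj (v i) * A i j * v j) - cnj s * s / a" .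
    have "0 \<le> (\<Sum>i<n. \<Sum>j<n. cnj (w i) * A i j * w j) + cnj (\<Sum>j<n. A n j * w j) * w n
        + cnj (w n) * (\<Sum>j<n. A n j * w j) + cnj (w n) * a * w n"
      using Suc.prems(2)[of w] unfolding split .
    also have "(\<Sum>i<n. \<Sum>j<n. cnj (w i) * A i j * w j) = (\<Sum>i<n. \<Sum>j<n. cnj (v i) * A i j * v j)"
      by (intro sum.cong) (auto simp: w_def)
    also have "(\<Sum>j<n. A n j * w j) = s"
      unfolding s_def by (intro sum.cong) (auto simp: w_def)
    also have "w n = - s / a" by (simp add: w_def)
    finally show "0 \<le> (\<Sum>i<n. \<Sum>j<n. cnj (v i) * B i j * v j)"
    proof -
      assume h: "0 \<le> (\<Sum>i<n. \<Sum>j<n. cnj (v i) * A i j * v j) + cnj s * (- s / a) + cnj (- s / a) * s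
          + cnj (- s / a) * a * (- s / a)"
      have ca: "cnj a = a" using a_real by (metis complex_cnj_complex_of_real)
      have "cnj s * (- s / a) + cnj (- s / a) * s + cnj (- s / a) * a * (- s / a) = - (cnj s * s / a)"
        by (cases "a = 0") (simp_all add: ca field_simps)
      then show ?thesis using h unfolding Bv by (simp add: add.assoc)
    qed
  qed
  then obtain X where X: "\<And>i j. i < n \<Longrightarrow> j < n \<Longrightarrow> B i j = (\<Sum>k<n. cnj (X k i) * X k j)" by auto
  define q where "q = complex_of_real (sqrt (Re a))"
  have q: "cnj q = q" "q * q = a"
    unfolding q_def using a_real by (simp_all flip: of_real_mult)
  \<comment> \<open>The new last row is that of \<open>A\<close> divided by the root of the pivot.
    For a zero pivot it is 0, which fits because \<open>zero\<close> then makes the last row and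
    column of \<open>A\<close> vanish.\<close>
  define Y where "Y k j = (if k = n then A n j / q else if j = n then 0 else X k j)" for k j
  have "A i j = (\<Sum>k<Suc n. cnj (Y k i) * Y k j)" if ij: "i < Suc n" "j < Suc n" for i j
  proof -
    have last: "cnj (Y n i) * Y n j = A i n * A n j / a"
      using Suc.prems(1)[of i n] Suc.prems(1)[of n i] ij q by (simp add: Y_def)
    show ?thesis
    proof (cases "i < n \<and> j < n")
      case True
      then have "(\<Sum>k<n. cnj (Y k i) * Y k j) = B i j"
        unfolding X[OF conjunct1[OF True] conjunct2[OF True]] by (intro sum.cong) (auto simp: Y_def)
      then show ?thesis using last by (simp add: B_def)
    next
      case False
      then have "(\<Sum>k<n. cnj (Y k i) * Y k j) = 0"
        using ij by (intro sum.neutral) (auto simp: Y_def)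
      moreover have "A i n * A n j / a = A i j"
      proof (cases "a = 0")
        case True
        then show ?thesis using zero[OF True] Suc.prems(1)[of i n] Suc.prems(1)[of n i] False ij
          by (auto simp: less_Suc_eq)
      next
        case a: False
        show ?thesis using False ij a by (auto simp: less_Suc_eq a_def)
      qed
      ultimately show ?thesis using last by simp
    qed
  qed
  then show ?case by blast
qed

lemma psd_factor:
  assumes "psd n A"
  shows "\<exists>X\<in>carrier_mat n n. A = adj X * X"
proof -
  have A: "A \<in> carrier_mat n n" and herm: "adj A = A"
    and pos: "\<And>v. v \<in> carrier_vec n \<Longrightarrow> 0 \<le> conjugate v \<bullet> (A *\<^sub>v v)"
    using assms by (auto simp: psd_def)
  have "\<exists>X. \<forall>i<n. \<forall>j<n. A $$ (i,j) = (\<Sum>k<n. cnj (X k i) * X k j)"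
  proof (rule cholesky)
    fix i j assume "i < n" "j < n"
    then show "A $$ (j,i) = cnj (A $$ (i,j))"
      using A adj_index[of j A i] unfolding herm by auto
  next
    fix v :: "nat \<Rightarrow> complex"
    have "0 \<le> conjugate (vec n v) \<bullet> (A *\<^sub>v vec n v)" by (rule pos) simp
    then show "0 \<le> (\<Sum>i<n. \<Sum>j<n. cnj (v i) * A $$ (i,j) * v j)"
      using A by (subst (asm) quadratic_form_sum[of _ n]) simp_all
  qed
  then obtain x where x: "\<And>i j. i < n \<Longrightarrow> j < n \<Longrightarrow> A $$ (i,j) = (\<Sum>k<n. cnj (x k i) * x k j)"
    by auto
  define X where "X = mat n n (\<lambda>(k,i). x k i)"
  have X: "X \<in> carrier_mat n n" by (simp add: X_def)
  have "A = adj X * X"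
  proof (rule eq_matI)
    fix i j assume "i < dim_row (adj X * X)" "j < dim_col (adj X * X)"
    then have ij: "i < n" "j < n" using X by auto
    then have "(adj X * X) $$ (i,j) = (\<Sum>k<n. adj X $$ (i,k) * X $$ (k,j))"
      using X by (intro mat_mult_index) auto
    also have "\<dots> = A $$ (i,j)" using ij X by (simp add: x X_def)
    finally show "A $$ (i,j) = (adj X * X) $$ (i,j)" by simp
  qed (use A X in auto)
  then show ?thesis using X by blast
qed

lemma conjugate_scalar_prod_adj:
  assumes "F \<in> carrier_mat n m" "v \<in> carrier_vec m" "w \<in> carrier_vec n"
  shows "conjugate v \<bullet> (adj F *\<^sub>v w) = conjugate (F *\<^sub>v v) \<bullet> w"
proof -
  have "conjugate v \<bullet> (adj F *\<^sub>v w) = (\<Sum>i<m. \<Sum>j<n. cnj (v $ i) * (cnj (F $$ (j,i)) * w $ j))"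
    using assms by (simp add: scalar_prod_def atLeast0LessThan sum_distrib_left)
  also have "\<dots> = (\<Sum>j<n. \<Sum>i<m. cnj (v $ i) * (cnj (F $$ (j,i)) * w $ j))" by (rule sum.swap)
  also have "\<dots> = conjugate (F *\<^sub>v v) \<bullet> w"
    using assms by (simp add: scalar_prod_def atLeast0LessThan sum_distrib_left mult_ac)
  finally show ?thesis .
qed

text \<open>\<open>F\<close> may be rectangular, so this covers both the restriction to a block and
  the conjugation by X.\<close>

lemma psd_compress:
  assumes "psd n A" and F: "F \<in> carrier_mat n m"
  shows "psd m (adj F * A * F)"
proof -
  have A: "A \<in> carrier_mat n n" and herm: "adj A = A"
    and pos: "\<And>v. v \<in> carrier_vec n \<Longrightarrow> 0 \<le> conjugate v \<bullet> (A *\<^sub>v v)"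
    using assms by (auto simp: psd_def)
  have "adj (adj F * A * F) = adj F * (adj A * F)"
    using A F by (subst adj_mult[of _ m n], auto, subst adj_mult[of _ m n], auto)
  moreover have "conjugate v \<bullet> (adj F * A * F *\<^sub>v v) \<ge> 0" if v: "v \<in> carrier_vec m" for v
  proof -
    have "adj F * A * F *\<^sub>v v = adj F *\<^sub>v (A *\<^sub>v (F *\<^sub>v v))"
      using A F v
      by (subst assoc_mult_mat_vec[of _ m n _ m], auto, subst assoc_mult_mat_vec[of _ m n _ n], auto)
    then show ?thesis
      using pos[of "F *\<^sub>v v"] A F v by (simp add: conjugate_scalar_prod_adj[of _ n m])
  qed
  ultimately show ?thesis
    using A F herm by (auto simp: psd_def assoc_mult_mat[of "adj F" m n A n F m])
qed

section \<open>Schur's lemma\<close>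

text \<open>The side conditions speak of dimensions instead of carriers, so that the simplifier can
  reassociate products without guessing sizes.\<close>

lemma mat_mult_assoc:
  fixes A B C :: "'a::semiring_0 mat"
  assumes "dim_col A = dim_row B" "dim_col B = dim_row C"
  shows "A * B * C = A * (B * C)"
  using assms by (intro assoc_mult_mat[of A "dim_row A" "dim_col A" B "dim_col B" C "dim_col C"]) auto

lemma mat_mult_adj: "dim_col A = dim_row B \<Longrightarrow> adj (A * B) = adj B * adj A"
  by (rule adj_mult[of A "dim_row A" "dim_col A" B "dim_col B"]) auto

lemma mat_mult_smult:
  fixes A B :: "'a::comm_semiring_1 mat"
  assumes "dim_col A = dim_row B"
  shows "A * (c \<cdot>\<^sub>m B) = c \<cdot>\<^sub>m (A * B)" "(c \<cdot>\<^sub>m A) * B = c \<cdot>\<^sub>m (A * B)"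
  by (rule mult_smult_distrib mult_smult_assoc_mat;
      rule carrier_matI[OF refl refl] carrier_matI[OF assms[symmetric] refl])+

text \<open>Over the complex numbers \<open>A\<close> has an eigenvalue, as \<open>d\<close> is
  positive. Its eigenspace \<open>W\<close> is invariant because \<open>A\<close> commutes with the
  representation, so irreducibility makes it the whole space.\<close>

lemma schur_scalar:
  assumes irr: "irreducible_rep G d \<pi>" and A: "A \<in> carrier_mat d d"
    and comm: "\<And>g. g \<in> carrier G \<Longrightarrow> A * \<pi> g = \<pi> g * A"
  shows "\<exists>c. A = c \<cdot>\<^sub>m 1\<^sub>m d"
proof -
  have d: "d > 0" and pi: "\<And>g. g \<in> carrier G \<Longrightarrow> \<pi> g \<in> carrier_mat d d"
    and inv: "\<And>W. lin_subspace d W \<Longrightarrow> (\<And>g w. g \<in> carrier G \<Longrightarrow> w \<in> W \<Longrightarrow> \<pi> g *\<^sub>v w \<in> W)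
      \<Longrightarrow> W = {0\<^sub>v d} \<or> W = carrier_vec d"
    using irr by (auto simp: irreducible_rep_def unitary_rep_def unitary_mat_def)
  from spectrum_non_empty[OF A d] obtain c v where
    v: "v \<in> carrier_vec d" "v \<noteq> 0\<^sub>v d" "A *\<^sub>v v = c \<cdot>\<^sub>v v"
    using A by (auto simp: spectrum_def eigenvalue_def eigenvector_def)
  define W where "W = {w \<in> carrier_vec d. A *\<^sub>v w = c \<cdot>\<^sub>v w}"
  have "lin_subspace d W"
    unfolding lin_subspace_def
  proof (intro conjI ballI allI)
    fix x y assume "x \<in> W" "y \<in> W"
    then show "x + y \<in> W"
      using A by (auto simp: W_def mult_add_distrib_mat_vec[of A d d] smult_add_distrib_vec[of _ d])
  next
    fix b x assume "x \<in> W"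
    then show "b \<cdot>\<^sub>v x \<in> W"
      using A by (auto simp: W_def mult_mat_vec[of A d d] smult_smult_assoc mult.commute[of b])
  qed (use A in \<open>auto simp: W_def\<close>)
  moreover have "\<pi> g *\<^sub>v w \<in> W" if g: "g \<in> carrier G" and w: "w \<in> W" for g w
  proof -
    have wd: "w \<in> carrier_vec d" "A *\<^sub>v w = c \<cdot>\<^sub>v w" using w by (auto simp: W_def)
    have "A *\<^sub>v (\<pi> g *\<^sub>v w) = \<pi> g *\<^sub>v (A *\<^sub>v w)"
      using assoc_mult_mat_vec[OF A pi[OF g] wd(1)] assoc_mult_mat_vec[OF pi[OF g] A wd(1)]
      by (simp add: comm[OF g])
    then show ?thesis using A pi[OF g] wd by (auto simp: W_def mult_mat_vec[of _ d d])
  qed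
  ultimately have "W = {0\<^sub>v d} \<or> W = carrier_vec d" by (rule inv)
  moreover have "v \<in> W" using v by (simp add: W_def)
  ultimately have W: "W = carrier_vec d" using v by auto
  have "A = c \<cdot>\<^sub>m 1\<^sub>m d"
  proof (rule mat_eq_of_mult_vec[OF A])
    fix w :: "complex vec" assume w: "w \<in> carrier_vec d"
    then have "A *\<^sub>v w = c \<cdot>\<^sub>v w" using W by (auto simp: W_def)
    also have "\<dots> = (c \<cdot>\<^sub>m 1\<^sub>m d) *\<^sub>v w" using w by auto
    finally show "A *\<^sub>v w = (c \<cdot>\<^sub>m 1\<^sub>m d) *\<^sub>v w" .
  qed simp
  then show ?thesis ..
qed

text \<open>Unitarity lets the relation be solved for the inverses,
  \<open>adj u2 * T = T * adj u1\<close>; taking adjoints gives the claim.\<close>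

lemma intertwiner_adj:
  assumes u: "unitary_mat d1 u1" "unitary_mat d2 u2" and T: "T \<in> carrier_mat d2 d1"
    and eq: "T * u1 = u2 * T"
  shows "adj T * u2 = u1 * adj T"
proof -
  have c: "u1 \<in> carrier_mat d1 d1" "u2 \<in> carrier_mat d2 d2"
    and i: "u1 * adj u1 = 1\<^sub>m d1" "adj u2 * u2 = 1\<^sub>m d2" using u by (auto simp: unitary_mat_def)
  have "adj u2 * T = adj u2 * (T * (u1 * adj u1))" using c T i by simp
  also have "\<dots> = adj u2 * ((T * u1) * adj u1)" using c T by (simp add: mat_mult_assoc)
  also have "\<dots> = (adj u2 * u2) * (T * adj u1)" using c T unfolding eq by (simp add: mat_mult_assoc)
  also have "\<dots> = T * adj u1" using c T i by simp
  finally have "adj (adj u2 * T) = adj (T * adj u1)" by simp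
  then show ?thesis using c T by (simp add: mat_mult_adj)
qed

text \<open>Both \<open>T\<^sup>\<dagger> T\<close> and \<open>T T\<^sup>\<dagger>\<close> are scalar, with the same scalar because \<open>T T\<^sup>\<dagger> T \<noteq> 0\<close>; comparing
  traces gives equality of the dimensions.\<close>

lemma schur_equivalent:
  assumes irr1: "irreducible_rep G d1 \<pi>1" and irr2: "irreducible_rep G d2 \<pi>2"
    and T: "T \<in> carrier_mat d2 d1" "T \<noteq> 0\<^sub>m d2 d1"
    and eq: "\<And>g. g \<in> carrier G \<Longrightarrow> T * \<pi>1 g = \<pi>2 g * T"
  shows "equivalent_reps G d1 \<pi>1 d2 \<pi>2"
proof -
  have u: "\<And>g. g \<in> carrier G \<Longrightarrow> unitary_mat d1 (\<pi>1 g)" "\<And>g. g \<in> carrier G \<Longrightarrow> unitary_mat d2 (\<pi>2 g)"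
    and d1: "d1 \<noteq> 0"
    using irr1 irr2 by (auto simp: irreducible_rep_def unitary_rep_def)
  have c: "\<And>g. g \<in> carrier G \<Longrightarrow> \<pi>1 g \<in> carrier_mat d1 d1" "\<And>g. g \<in> carrier G \<Longrightarrow> \<pi>2 g \<in> carrier_mat d2 d2"
    using u by (auto simp: unitary_mat_def)
  have eq': "adj T * \<pi>2 g = \<pi>1 g * adj T" if "g \<in> carrier G" for g
    using that u T eq by (intro intertwiner_adj[of d1 _ d2]) auto
  have "\<exists>a. adj T * T = a \<cdot>\<^sub>m 1\<^sub>m d1"
  proof (rule schur_scalar[OF irr1])
    fix g assume g: "g \<in> carrier G"
    have "adj T * T * \<pi>1 g = adj T * \<pi>2 g * T"
      using T c[OF g] eq[OF g] by (simp add: mat_mult_assoc)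
    then show "adj T * T * \<pi>1 g = \<pi>1 g * (adj T * T)"
      using T c[OF g] eq'[OF g] by (simp add: mat_mult_assoc)
  qed (use T in auto)
  then obtain a where a: "adj T * T = a \<cdot>\<^sub>m 1\<^sub>m d1" ..
  have "\<exists>b. T * adj T = b \<cdot>\<^sub>m 1\<^sub>m d2"
  proof (rule schur_scalar[OF irr2])
    fix g assume g: "g \<in> carrier G"
    have "T * adj T * \<pi>2 g = T * \<pi>1 g * adj T"
      using T c[OF g] eq'[OF g] by (simp add: mat_mult_assoc)
    then show "T * adj T * \<pi>2 g = \<pi>2 g * (T * adj T)"
      using T c[OF g] eq[OF g] by (simp add: mat_mult_assoc)
  qed (use T in auto)
  then obtain b where b: "T * adj T = b \<cdot>\<^sub>m 1\<^sub>m d2" ..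
  have tr: "mtrace (x \<cdot>\<^sub>m 1\<^sub>m k) = x * of_nat k" for x k
    by (simp add: mtrace_def)
  have "a \<noteq> 0"
    using mtrace_adj_mult_eq_0_iff[OF T(1)] T(2) by (auto simp: a tr)
  have "a \<cdot>\<^sub>m T = T * (adj T * T)" unfolding a using T by (simp add: mat_mult_smult)
  also have "\<dots> = T * adj T * T" using T by (simp add: mat_mult_assoc)
  also have "\<dots> = b \<cdot>\<^sub>m T" unfolding b using T by (simp add: mat_mult_smult)
  finally have ab: "a \<cdot>\<^sub>m T = b \<cdot>\<^sub>m T" .
  have "a = b"
  proof (rule ccontr)
    assume "a \<noteq> b"
    then have "T $$ (i,j) = 0" if "i < d2" "j < d1" for i j
      using arg_cong[OF ab, of "\<lambda>M. M $$ (i,j)"] that T by simp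
    then have "T = 0\<^sub>m d2 d1" using T by (intro eq_matI) auto
    then show False using T by simp
  qed
  have "a * of_nat d1 = b * of_nat d2"
    using mtrace_comm[of "adj T" d1 d2 T] T by (simp add: a b tr)
  then have d: "d1 = d2" using \<open>a = b\<close> \<open>a \<noteq> 0\<close> by simp
  have "invertible_mat T"
    unfolding invertible_mat_def
  proof (intro conjI exI)
    show "inverts_mat T ((1 / a) \<cdot>\<^sub>m adj T)" "inverts_mat ((1 / a) \<cdot>\<^sub>m adj T) T"
      using T \<open>a \<noteq> 0\<close> \<open>a = b\<close> a b d
      by (auto simp: inverts_mat_def mat_mult_smult)
  qed (use T d in simp)
  then show ?thesis unfolding equivalent_reps_def using T d eq by auto
qed

text \<open>Reads \<open>T\<close> as an \<open>m2\<close> by \<open>m1\<close> array of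
  \<open>d2\<close> by \<open>d1\<close> matrices indexed by the multiplicity spaces:
  \<open>T\<close> is the sum over \<open>a\<close>, \<open>b\<close> of these slices tensored with
  the matrix units E_ab.\<close>

definition tensor_block :: "complex mat \<Rightarrow> nat \<Rightarrow> nat \<Rightarrow> nat \<Rightarrow> nat \<Rightarrow> nat \<Rightarrow> nat \<Rightarrow> complex mat" where
  "tensor_block T d2 m2 a d1 m1 b = mat d2 d1 (\<lambda>(i,j). T $$ (i * m2 + a, j * m1 + b))"

text \<open>Both actions are trivial on the multiplicity space, so the intertwining relation
  decouples into one relation per slice.\<close>

lemma tensor_block_intertwines:
  assumes A: "A \<in> carrier_mat d1 d1" and B: "B \<in> carrier_mat d2 d2"
    and T: "T \<in> carrier_mat (d2 * m2) (d1 * m1)"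
    and eq: "T * kron A (1\<^sub>m m1) = kron B (1\<^sub>m m2) * T"
    and ab: "a < m2" "b < m1"
  shows "tensor_block T d2 m2 a d1 m1 b * A = B * tensor_block T d2 m2 a d1 m1 b"
proof -
  define S where "S = tensor_block T d2 m2 a d1 m1 b"
  have S: "S \<in> carrier_mat d2 d1" by (simp add: S_def tensor_block_def)
  have Sij: "S $$ (i,j) = T $$ (i * m2 + a, j * m1 + b)" if "i < d2" "j < d1" for i j
    using that by (simp add: S_def tensor_block_def)
  have "S * A = B * S"
  proof (rule eq_matI)
    fix i j assume "i < dim_row (B * S)" "j < dim_col (B * S)"
    then have ij: "i < d2" "j < d1" using B S by auto
    note idx = mult_add_less_mult[OF ij(1) ab(1)] mult_add_less_mult[OF ij(2) ab(2)]
    have "(S * A) $$ (i,j) = (\<Sum>x<d1. T $$ (i * m2 + a, x * m1 + b) * A $$ (x,j))"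
      using ij by (subst mat_mult_index[OF S A]) (simp_all add: Sij)
    also have "\<dots> = (\<Sum>x<d1. \<Sum>y<m1. if y = b then T $$ (i * m2 + a, x * m1 + b) * A $$ (x,j) else 0)"
      using ab by simp
    also have "\<dots> = (\<Sum>x<d1. \<Sum>y<m1. T $$ (i * m2 + a, x * m1 + y) * kron A (1\<^sub>m m1) $$ (x * m1 + y, j * m1 + b))"
      using A ab ij by (intro sum.cong refl) (simp add: kron_index[of _ d1 d1 _ m1 m1] mult_add_less_mult)
    also have "\<dots> = (T * kron A (1\<^sub>m m1)) $$ (i * m2 + a, j * m1 + b)"
      using A T idx
      by (subst mat_mult_index[of _ "d2 * m2" "d1 * m1" _ "d1 * m1"]) (auto simp: sum_lessThan_mult)
    also have "\<dots> = (\<Sum>x<d2. \<Sum>y<m2. kron B (1\<^sub>m m2) $$ (i * m2 + a, x * m2 + y) * T $$ (x * m2 + y, j * m1 + b))"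
      unfolding eq using B T idx
      by (subst mat_mult_index[of _ "d2 * m2" "d2 * m2" _ "d1 * m1"]) (auto simp: sum_lessThan_mult)
    also have "\<dots> = (\<Sum>x<d2. \<Sum>y<m2. if y = a then B $$ (i,x) * T $$ (x * m2 + a, j * m1 + b) else 0)"
      using B ab ij by (intro sum.cong refl) (simp add: kron_index[of _ d2 d2 _ m2 m2] mult_add_less_mult)
    also have "\<dots> = (\<Sum>x<d2. B $$ (i,x) * T $$ (x * m2 + a, j * m1 + b))"
      using ab by simp
    also have "\<dots> = (B * S) $$ (i,j)"
      using ij by (subst mat_mult_index[OF B S]) (simp_all add: Sij)
    finally show "(S * A) $$ (i,j) = (B * S) $$ (i,j)" .
  qed (use A B S in auto)
  then show ?thesis by (simp add: S_def)
qed

lemma tensor_block_index: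
  assumes "T \<in> carrier_mat (d2 * m2) (d1 * m1)" "i < d2 * m2" "j < d1 * m1"
  shows "T $$ (i,j) = tensor_block T d2 m2 (i mod m2) d1 m1 (j mod m1) $$ (i div m2, j div m1)"
  using assms div_mod_less_mult[OF assms(2)] div_mod_less_mult[OF assms(3)]
  by (simp add: tensor_block_def)

text \<open>A nonzero slice would be an intertwiner making the two irreducible representations
  equivalent.\<close>

lemma tensor_intertwiner_inequivalent:
  assumes "irreducible_rep G d1 \<pi>1" "irreducible_rep G d2 \<pi>2" "\<not> equivalent_reps G d1 \<pi>1 d2 \<pi>2"
    and T: "T \<in> carrier_mat (d2 * m2) (d1 * m1)"
    and eq: "\<And>g. g \<in> carrier G \<Longrightarrow> T * kron (\<pi>1 g) (1\<^sub>m m1) = kron (\<pi>2 g) (1\<^sub>m m2) * T"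
  shows "T = 0\<^sub>m (d2 * m2) (d1 * m1)"
proof (rule eq_matI)
  fix i j assume "i < dim_row (0\<^sub>m (d2 * m2) (d1 * m1) :: complex mat)"
    "j < dim_col (0\<^sub>m (d2 * m2) (d1 * m1) :: complex mat)"
  then have ij: "i < d2 * m2" "j < d1 * m1" by auto
  note b = div_mod_less_mult[OF ij(1)] div_mod_less_mult[OF ij(2)]
  define S where "S = tensor_block T d2 m2 (i mod m2) d1 m1 (j mod m1)"
  have "S * \<pi>1 g = \<pi>2 g * S" if "g \<in> carrier G" for g
    unfolding S_def using assms(1,2) eq[OF that] that T b
    by (intro tensor_block_intertwines)
      (auto simp: irreducible_rep_def unitary_rep_def unitary_mat_def)
  then have "S = 0\<^sub>m d2 d1"
    using schur_equivalent[OF assms(1,2), of S] assms(3) by (auto simp: S_def tensor_block_def)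
  then show "T $$ (i,j) = 0\<^sub>m (d2 * m2) (d1 * m1) $$ (i,j)"
    using tensor_block_index[OF T ij] ij b by (simp add: S_def)
qed (use T in auto)

text \<open>Each slice is a scalar by Schur's lemma, and these scalars are the entries of
  \<open>M\<close>.\<close>

lemma tensor_intertwiner_self:
  assumes irr: "irreducible_rep G d \<pi>"
    and T: "T \<in> carrier_mat (d * m) (d * m)"
    and eq: "\<And>g. g \<in> carrier G \<Longrightarrow> T * kron (\<pi> g) (1\<^sub>m m) = kron (\<pi> g) (1\<^sub>m m) * T"
  shows "\<exists>M\<in>carrier_mat m m. T = kron (1\<^sub>m d) M"
proof -
  have "\<exists>c. tensor_block T d m a d m b = c \<cdot>\<^sub>m 1\<^sub>m d" if ab: "a < m" "b < m" for a b
  proof (rule schur_scalar[OF irr])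
    fix g assume g: "g \<in> carrier G"
    show "tensor_block T d m a d m b * \<pi> g = \<pi> g * tensor_block T d m a d m b"
      using irr eq[OF g] g T ab
      by (intro tensor_block_intertwines)
        (auto simp: irreducible_rep_def unitary_rep_def unitary_mat_def)
  qed (simp add: tensor_block_def)
  then obtain c where c: "\<And>a b. a < m \<Longrightarrow> b < m \<Longrightarrow> tensor_block T d m a d m b = c a b \<cdot>\<^sub>m 1\<^sub>m d"
    by metis
  define M where "M = mat m m (\<lambda>(a,b). c a b)"
  have M: "M \<in> carrier_mat m m" by (simp add: M_def)
  have "T = kron (1\<^sub>m d) M"
  proof (rule eq_matI)
    fix i j assume "i < dim_row (kron (1\<^sub>m d) M)" "j < dim_col (kron (1\<^sub>m d) M)"
    then have ij: "i < d * m" "j < d * m" using M by (auto simp: kron_def)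
    note b = div_mod_less_mult[OF ij(1)] div_mod_less_mult[OF ij(2)]
    show "T $$ (i,j) = kron (1\<^sub>m d) M $$ (i,j)"
      using b ij M unfolding tensor_block_index[OF T ij]
      by (subst kron_index[of _ d d _ m m]) (auto simp: c M_def)
  qed (use T M in \<open>auto simp: kron_def\<close>)
  then show ?thesis using M by blast
qed

section \<open>Finite sums of square matrices\<close>

lemma msum_carrier [simp, intro]: "msum n N F \<in> carrier_mat n n"
  and msum_dim [simp]: "dim_row (msum n N F) = n" "dim_col (msum n N F) = n"
  and msum_index [simp]: "i < n \<Longrightarrow> j < n \<Longrightarrow> msum n N F $$ (i,j) = (\<Sum>k<N. F k $$ (i,j))"
  by (simp_all add: msum_def)

lemma msum_cong: "(\<And>k. k < N \<Longrightarrow> F k = F' k) \<Longrightarrow> msum n N F = msum n N F'"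
  unfolding msum_def by (intro cong_mat) auto

lemma mult_msum:
  assumes "A \<in> carrier_mat n n" "\<And>k. k < N \<Longrightarrow> F k \<in> carrier_mat n n"
  shows "A * msum n N F = msum n N (\<lambda>k. A * F k)"
proof (rule eq_matI)
  fix i j assume "i < dim_row (msum n N (\<lambda>k. A * F k))" "j < dim_col (msum n N (\<lambda>k. A * F k))"
  then have ij: "i < n" "j < n" by auto
  have "(A * msum n N F) $$ (i,j) = (\<Sum>l<n. \<Sum>k<N. A $$ (i,l) * F k $$ (l,j))"
    using ij assms(1) by (subst mat_mult_index[of _ n n _ n]) (auto simp: sum_distrib_left)
  also have "\<dots> = (\<Sum>k<N. \<Sum>l<n. A $$ (i,l) * F k $$ (l,j))" by (rule sum.swap)
  also have "\<dots> = (\<Sum>k<N. (A * F k) $$ (i,j))"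
    using ij assms by (intro sum.cong refl mat_mult_index[of A n n _ n, symmetric]) auto
  finally show "(A * msum n N F) $$ (i,j) = msum n N (\<lambda>k. A * F k) $$ (i,j)" using ij by simp
qed (use assms in auto)

lemma adj_msum:
  assumes "\<And>k. k < N \<Longrightarrow> F k \<in> carrier_mat n n"
  shows "adj (msum n N F) = msum n N (\<lambda>k. adj (F k))"
proof (rule eq_matI)
  fix i j assume "i < dim_row (msum n N (\<lambda>k. adj (F k)))" "j < dim_col (msum n N (\<lambda>k. adj (F k)))"
  then have ij: "i < n" "j < n" by auto
  have "adj (F k) $$ (i,j) = cnj (F k $$ (j,i))" if "k < N" for k
    using assms[OF that] ij by simp
  then show "adj (msum n N F) $$ (i,j) = msum n N (\<lambda>k. adj (F k)) $$ (i,j)" using ij by simp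
qed auto

text \<open>The mirror image of \<open>mult_msum\<close> under adjoints.\<close>

lemma msum_mult:
  assumes "A \<in> carrier_mat n n" "\<And>k. k < N \<Longrightarrow> F k \<in> carrier_mat n n"
  shows "msum n N F * A = msum n N (\<lambda>k. F k * A)"
proof -
  have "adj (msum n N F * A) = adj A * msum n N (\<lambda>k. adj (F k))"
    using assms adj_mult[of "msum n N F" n n A n] by (simp add: adj_msum)
  also have "\<dots> = msum n N (\<lambda>k. adj A * adj (F k))"
    using assms by (intro mult_msum) auto
  also have "\<dots> = msum n N (\<lambda>k. adj (F k * A))"
    using assms by (intro msum_cong) (simp add: adj_mult[of _ n n _ n])
  also have "\<dots> = adj (msum n N (\<lambda>k. F k * A))"
    using assms by (intro adj_msum[symmetric] mult_carrier_mat[of _ n n]) auto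
  finally show ?thesis by (metis adj_adj)
qed

lemma msum_single:
  assumes "l < N" "F l \<in> carrier_mat n n" "\<And>k. k < N \<Longrightarrow> k \<noteq> l \<Longrightarrow> F k = 0\<^sub>m n n"
  shows "msum n N F = F l"
proof (rule eq_matI)
  fix i j assume "i < dim_row (F l)" "j < dim_col (F l)"
  then have ij: "i < n" "j < n" using assms(2) by auto
  then have "(\<Sum>k<N. F k $$ (i,j)) = (\<Sum>k<N. if k = l then F l $$ (i,j) else 0)"
    using assms(3) by (intro sum.cong) auto
  then show "msum n N F $$ (i,j) = F l $$ (i,j)" using ij assms(1) by simp
qed (use assms in auto)

lemma mtrace_msum:
  assumes "\<And>k. k < N \<Longrightarrow> F k \<in> carrier_mat n n"
  shows "mtrace (msum n N F) = (\<Sum>k<N. mtrace (F k))"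
proof -
  have "(\<Sum>k<N. mtrace (F k)) = (\<Sum>k<N. \<Sum>i<n. F k $$ (i,i))"
    using assms by (intro sum.cong) (auto simp: mtrace_def)
  then show ?thesis by (simp add: mtrace_def sum.swap[of _ "{..<N}"])
qed

section \<open>The commutant of an isotypic decomposition\<close>

lemma commutant_mult:
  assumes "\<And>g. g \<in> carrier G \<Longrightarrow> \<rho> g \<in> carrier_mat n n" "A \<in> commutant G n \<rho>" "B \<in> commutant G n \<rho>"
  shows "A * B \<in> commutant G n \<rho>"
proof -
  have c: "A \<in> carrier_mat n n" "B \<in> carrier_mat n n" using assms by (auto simp: commutant_def)
  have "A * B * \<rho> g = \<rho> g * (A * B)" if g: "g \<in> carrier G" for g
  proof -
    have "A * B * \<rho> g = A * (\<rho> g * B)"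
      using assms(2,3) assms(1)[OF g] g by (auto simp: mat_mult_assoc commutant_def)
    also have "\<dots> = A * \<rho> g * B" using assms(1)[OF g] c by (simp add: mat_mult_assoc)
    also have "\<dots> = \<rho> g * A * B" using assms g by (simp add: commutant_def)
    also have "\<dots> = \<rho> g * (A * B)" using assms(1)[OF g] c by (simp add: mat_mult_assoc)
    finally show ?thesis .
  qed
  then show ?thesis using c by (simp add: commutant_def)
qed

lemma commutant_add:
  assumes "\<And>g. g \<in> carrier G \<Longrightarrow> \<rho> g \<in> carrier_mat n n" "A \<in> commutant G n \<rho>" "B \<in> commutant G n \<rho>"
  shows "A + B \<in> commutant G n \<rho>"
proof -
  have c: "A \<in> carrier_mat n n" "B \<in> carrier_mat n n" using assms by (auto simp: commutant_def)
  have "(A + B) * \<rho> g = \<rho> g * (A + B)" if g: "g \<in> carrier G" for g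
    using assms(2,3) g
    by (simp add: add_mult_distrib_mat[OF c assms(1)[OF g]] mult_add_distrib_mat[OF assms(1)[OF g] c]
        commutant_def)
  then show ?thesis using c by (simp add: commutant_def)
qed

lemma commutant_smult:
  assumes "\<And>g. g \<in> carrier G \<Longrightarrow> \<rho> g \<in> carrier_mat n n" "A \<in> commutant G n \<rho>"
  shows "c \<cdot>\<^sub>m A \<in> commutant G n \<rho>"
proof -
  have A: "A \<in> carrier_mat n n" using assms by (auto simp: commutant_def)
  have "(c \<cdot>\<^sub>m A) * \<rho> g = \<rho> g * (c \<cdot>\<^sub>m A)" if g: "g \<in> carrier G" for g
    using assms(2) g A assms(1)[OF g] by (simp add: mat_mult_smult commutant_def)
  then show ?thesis using A by (simp add: commutant_def)
qed

lemma commutant_one: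
  assumes "\<And>g. g \<in> carrier G \<Longrightarrow> \<rho> g \<in> carrier_mat n n"
  shows "1\<^sub>m n \<in> commutant G n \<rho>"
  using left_mult_one_mat[OF assms] right_mult_one_mat[OF assms] by (simp add: commutant_def)

locale isotypic =
  fixes G :: "('g, 'b) monoid_scheme" and n :: nat and \<rho> :: "'g \<Rightarrow> complex mat" and N :: nat
    and d m :: "nat \<Rightarrow> nat" and \<pi> :: "nat \<Rightarrow> 'g \<Rightarrow> complex mat" and J :: "nat \<Rightarrow> complex mat"
  assumes dec: "isotypic_decomp G n \<rho> N d m \<pi> J"
    and rho_carrier: "\<And>g. g \<in> carrier G \<Longrightarrow> \<rho> g \<in> carrier_mat n n"
begin

text \<open>Transports an operator on the \<open>k\<close>-th block to the whole space; the identity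
  is sent to the projector P_k of the theorem.\<close>

abbreviation sandwich :: "nat \<Rightarrow> complex mat \<Rightarrow> complex mat" where
  "sandwich k A \<equiv> J k * A * adj (J k)"

abbreviation block_family :: "(nat \<Rightarrow> complex mat) \<Rightarrow> bool" where
  "block_family M \<equiv> \<forall>k<N. M k \<in> carrier_mat (m k) (m k)"

abbreviation bop :: "(nat \<Rightarrow> complex mat) \<Rightarrow> complex mat" where
  "bop \<equiv> blockop n N d J"

lemma irr: "k < N \<Longrightarrow> irreducible_rep G (d k) (\<pi> k)"
  and J_carrier: "k < N \<Longrightarrow> J k \<in> carrier_mat n (d k * m k)"
  and J_isometry: "k < N \<Longrightarrow> adj (J k) * J k = 1\<^sub>m (d k * m k)"
  and rho_J: "k < N \<Longrightarrow> g \<in> carrier G \<Longrightarrow> \<rho> g * J k = J k * kron (\<pi> k g) (1\<^sub>m (m k))"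
  and J_orthogonal: "k < N \<Longrightarrow> l < N \<Longrightarrow> k \<noteq> l \<Longrightarrow> adj (J k) * J l = 0\<^sub>m (d k * m k) (d l * m l)"
  and inequivalent: "k < N \<Longrightarrow> l < N \<Longrightarrow> k \<noteq> l \<Longrightarrow> \<not> equivalent_reps G (d k) (\<pi> k) (d l) (\<pi> l)"
  and J_complete: "msum n N (\<lambda>k. J k * adj (J k)) = 1\<^sub>m n"
  using dec by (simp_all add: isotypic_decomp_def)

lemma d_nonzero: "k < N \<Longrightarrow> d k \<noteq> 0"
  using irr by (auto simp: irreducible_rep_def)

lemma pi_carrier: "k < N \<Longrightarrow> g \<in> carrier G \<Longrightarrow> \<pi> k g \<in> carrier_mat (d k) (d k)"
  using irr by (auto simp: irreducible_rep_def unitary_rep_def unitary_mat_def)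

lemma J_dim [simp]:
  assumes "k < N"
  shows "dim_row (J k) = n" "dim_col (J k) = d k * m k"
  using J_carrier[OF assms] by auto

text \<open>Products are normalised by nesting to the right, so the isometry relation is needed with
  a trailing factor. \<open>J_cross_cancel\<close> is its counterpart for two different
  blocks.\<close>

lemma J_cancel:
  assumes "k < N" "dim_row A = d k * m k"
  shows "adj (J k) * (J k * A) = A"
proof -
  have "adj (J k) * (J k * A) = adj (J k) * J k * A"
    using assms by (simp add: mat_mult_assoc)
  then show ?thesis
    using left_mult_one_mat[OF carrier_matI[OF assms(2) refl]] by (simp add: J_isometry[OF assms(1)])
qed

lemma J_cross_cancel:
  assumes "k < N" "l < N" "k \<noteq> l" "dim_row A = d l * m l"
  shows "adj (J k) * (J l * A) = 0\<^sub>m (d k * m k) (dim_col A)"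
proof -
  have "adj (J k) * (J l * A) = adj (J k) * J l * A"
    using assms by (simp add: mat_mult_assoc)
  then show ?thesis using assms by (simp add: J_orthogonal)
qed

lemma sandwich_carrier:
  assumes "k < N" "A \<in> carrier_mat (d k * m k) (d k * m k)"
  shows "sandwich k A \<in> carrier_mat n n"
  using assms by (intro carrier_matI) auto

lemma sandwich_mult:
  assumes "k < N" "A \<in> carrier_mat (d k * m k) (d k * m k)" "B \<in> carrier_mat (d k * m k) (d k * m k)"
  shows "sandwich k A * sandwich k B = sandwich k (A * B)"
  using assms by (simp add: mat_mult_assoc J_cancel)

lemma sandwich_mult_neq:
  assumes "k < N" "l < N" "k \<noteq> l"
    and "A \<in> carrier_mat (d k * m k) (d k * m k)" "B \<in> carrier_mat (d l * m l) (d l * m l)"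
  shows "sandwich k A * sandwich l B = 0\<^sub>m n n"
  using assms by (simp add: mat_mult_assoc J_cross_cancel)

lemma adj_sandwich:
  assumes "k < N" "A \<in> carrier_mat (d k * m k) (d k * m k)"
  shows "adj (sandwich k A) = sandwich k (adj A)"
  using assms by (simp add: mat_mult_adj mat_mult_assoc)

lemma sandwich_compress:
  assumes "k < N" "A \<in> carrier_mat (d k * m k) (d k * m k)"
  shows "adj (J k) * sandwich k A * J k = A"
  using assms J_cancel[OF assms(1), of A] by (simp add: mat_mult_assoc J_cancel J_isometry)

lemma J_adj_eq_sandwich:
  assumes "k < N"
  shows "J k * adj (J k) = sandwich k (1\<^sub>m (d k * m k))"
  using J_carrier[OF assms] by simp

lemma sandwich_one_complete: "msum n N (\<lambda>k. sandwich k (1\<^sub>m (d k * m k))) = 1\<^sub>m n"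
proof -
  have "msum n N (\<lambda>k. sandwich k (1\<^sub>m (d k * m k))) = msum n N (\<lambda>k. J k * adj (J k))"
    by (rule msum_cong) (simp only: J_adj_eq_sandwich)
  then show ?thesis by (simp add: J_complete)
qed

lemma kron_block_carrier:
  "k < N \<Longrightarrow> M \<in> carrier_mat (m k) (m k) \<Longrightarrow> kron (1\<^sub>m (d k)) M \<in> carrier_mat (d k * m k) (d k * m k)"
  by auto

lemma kron_pi_carrier:
  "k < N \<Longrightarrow> g \<in> carrier G \<Longrightarrow> kron (\<pi> k g) (1\<^sub>m (m k)) \<in> carrier_mat (d k * m k) (d k * m k)"
  using pi_carrier by auto

text \<open>Inserting the resolution of the identity on the right makes the action block diagonal,
  so that commutation with it can be checked in each block.\<close>

lemma rho_eq:
  assumes g: "g \<in> carrier G"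
  shows "\<rho> g = msum n N (\<lambda>k. sandwich k (kron (\<pi> k g) (1\<^sub>m (m k))))"
proof -
  have "\<rho> g = \<rho> g * msum n N (\<lambda>k. J k * adj (J k))"
    using rho_carrier[OF g] by (simp add: J_complete)
  also have "\<dots> = msum n N (\<lambda>k. \<rho> g * (J k * adj (J k)))"
    using rho_carrier[OF g] by (intro mult_msum) (auto intro!: carrier_matI)
  also have "\<dots> = msum n N (\<lambda>k. sandwich k (kron (\<pi> k g) (1\<^sub>m (m k))))"
  proof (rule msum_cong)
    fix k assume k: "k < N"
    have "\<rho> g * (J k * adj (J k)) = \<rho> g * J k * adj (J k)"
      using rho_carrier[OF g] k by (simp add: mat_mult_assoc)
    then show "\<rho> g * (J k * adj (J k)) = sandwich k (kron (\<pi> k g) (1\<^sub>m (m k)))"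
      using rho_J[OF k g] by simp
  qed
  finally show ?thesis .
qed

lemma sandwich_mult_msum:
  assumes "k < N" "A \<in> carrier_mat (d k * m k) (d k * m k)"
    and F: "\<And>l. l < N \<Longrightarrow> F l \<in> carrier_mat (d l * m l) (d l * m l)"
  shows "sandwich k A * msum n N (\<lambda>l. sandwich l (F l)) = sandwich k (A * F k)"
    and "msum n N (\<lambda>l. sandwich l (F l)) * sandwich k A = sandwich k (F k * A)"
proof -
  have "sandwich k A * msum n N (\<lambda>l. sandwich l (F l)) = msum n N (\<lambda>l. sandwich k A * sandwich l (F l))"
    using assms by (intro mult_msum sandwich_carrier)
  also have "\<dots> = sandwich k A * sandwich k (F k)"
    using assms
    by (intro msum_single sandwich_mult_neq mult_carrier_mat[of _ n n] sandwich_carrier) auto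
  finally show "sandwich k A * msum n N (\<lambda>l. sandwich l (F l)) = sandwich k (A * F k)"
    using sandwich_mult[OF assms(1,2) F[OF assms(1)]] by simp
  have "msum n N (\<lambda>l. sandwich l (F l)) * sandwich k A = msum n N (\<lambda>l. sandwich l (F l) * sandwich k A)"
    using assms by (intro msum_mult sandwich_carrier)
  also have "\<dots> = sandwich k (F k) * sandwich k A"
    using assms
    by (intro msum_single sandwich_mult_neq mult_carrier_mat[of _ n n] sandwich_carrier) auto
  finally show "msum n N (\<lambda>l. sandwich l (F l)) * sandwich k A = sandwich k (F k * A)"
    using sandwich_mult[OF assms(1) F[OF assms(1)] assms(2)] by simp
qed

lemma bop_eq: "bop M = msum n N (\<lambda>k. sandwich k (kron (1\<^sub>m (d k)) (M k)))"
  by (simp add: blockop_def)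

lemma bop_carrier: "bop M \<in> carrier_mat n n"
  by (simp add: bop_eq)

lemma bop_dim [simp]: "dim_row (bop M) = n" "dim_col (bop M) = n"
  using bop_carrier by auto

lemma bop_cong: "(\<And>k. k < N \<Longrightarrow> M k = M' k) \<Longrightarrow> bop M = bop M'"
  unfolding bop_eq by (rule msum_cong) simp

lemma bop_mult:
  assumes "block_family A" "block_family B"
  shows "bop A * bop B = bop (\<lambda>k. A k * B k)"
proof -
  have "bop A * bop B = msum n N (\<lambda>k. sandwich k (kron (1\<^sub>m (d k)) (A k)) * bop B)"
    using assms by (subst (1) bop_eq) (intro msum_mult bop_carrier sandwich_carrier; auto)
  also have "\<dots> = bop (\<lambda>k. A k * B k)"
    unfolding bop_eq
  proof (rule msum_cong)
    fix k assume k: "k < N"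
    have "sandwich k (kron (1\<^sub>m (d k)) (A k)) * msum n N (\<lambda>k. sandwich k (kron (1\<^sub>m (d k)) (B k)))
        = sandwich k (kron (1\<^sub>m (d k)) (A k) * kron (1\<^sub>m (d k)) (B k))"
      using assms k by (intro sandwich_mult_msum) auto
    also have "kron (1\<^sub>m (d k)) (A k) * kron (1\<^sub>m (d k)) (B k) = kron (1\<^sub>m (d k)) (A k * B k)"
      using assms k by (subst kron_mult[of _ "d k" "d k" _ "m k" "m k" _ "d k" _ "m k"]) auto
    finally show "sandwich k (kron (1\<^sub>m (d k)) (A k)) * msum n N (\<lambda>k. sandwich k (kron (1\<^sub>m (d k)) (B k)))
        = sandwich k (kron (1\<^sub>m (d k)) (A k * B k))" .
  qed
  finally show ?thesis .
qed

lemma adj_bop: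
  assumes "block_family A"
  shows "adj (bop A) = bop (\<lambda>k. adj (A k))"
proof -
  have "adj (bop A) = msum n N (\<lambda>k. adj (sandwich k (kron (1\<^sub>m (d k)) (A k))))"
    unfolding bop_eq using assms by (intro adj_msum sandwich_carrier kron_block_carrier) auto
  also have "\<dots> = bop (\<lambda>k. adj (A k))"
    unfolding bop_eq using assms
    by (intro msum_cong) (simp add: adj_sandwich kron_block_carrier adj_kron)
  finally show ?thesis .
qed

text \<open>Compression recovers a single block. This gives the uniqueness of the block family in
  \<open>bop_eq_iff\<close> and lets positivity pass to the blocks.\<close>

lemma bop_compress:
  assumes "block_family A" and k: "k < N"
  shows "adj (J k) * bop A * J k = kron (1\<^sub>m (d k)) (A k)"
proof -
  let ?K = "kron (1\<^sub>m (d k)) (A k)"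
  have K: "?K \<in> carrier_mat (d k * m k) (d k * m k)" using assms by auto
  have "sandwich k (1\<^sub>m (d k * m k)) * bop A = sandwich k (1\<^sub>m (d k * m k) * ?K)"
    unfolding bop_eq using assms by (intro sandwich_mult_msum) auto
  then have eq: "J k * (adj (J k) * bop A) = sandwich k ?K"
    using K k by (simp add: mat_mult_assoc J_carrier J_adj_eq_sandwich[symmetric])
  have "adj (J k) * bop A = adj (J k) * (J k * (adj (J k) * bop A))"
    using k by (simp add: J_cancel)
  also have "\<dots> = adj (J k) * sandwich k ?K" unfolding eq ..
  finally show ?thesis using sandwich_compress[OF k K] by simp
qed

lemma bop_eq_iff:
  assumes "block_family A" "block_family B"
  shows "bop A = bop B \<longleftrightarrow> (\<forall>k<N. A k = B k)"
proof
  assume eq: "bop A = bop B"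
  show "\<forall>k<N. A k = B k"
  proof (intro allI impI)
    fix k assume k: "k < N"
    have "kron (1\<^sub>m (d k)) (A k) = kron (1\<^sub>m (d k)) (B k)"
      using bop_compress[OF assms(1) k] bop_compress[OF assms(2) k] eq by simp
    from kron_one_inject[OF this _ _ d_nonzero[OF k]] show "A k = B k" using assms k by blast
  qed
qed (auto intro: bop_cong)

text \<open>In block \<open>k\<close> the products in either order are
  \<open>kron (\<pi> k g) (A k)\<close>.\<close>

lemma bop_commutant:
  assumes "block_family A"
  shows "bop A \<in> commutant G n \<rho>"
  unfolding commutant_def
proof (intro CollectI conjI ballI)
  fix g assume g: "g \<in> carrier G"
  have K: "kron (1\<^sub>m (d k)) (A k) \<in> carrier_mat (d k * m k) (d k * m k)" if "k < N" for k
    using assms that by auto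
  have "bop A * \<rho> g = msum n N (\<lambda>k. sandwich k (kron (1\<^sub>m (d k)) (A k)) * \<rho> g)"
    unfolding bop_eq using K by (intro msum_mult sandwich_carrier rho_carrier g)
  also have "\<dots> = msum n N (\<lambda>k. \<rho> g * sandwich k (kron (1\<^sub>m (d k)) (A k)))"
  proof (rule msum_cong)
    fix k assume k: "k < N"
    have "kron (1\<^sub>m (d k)) (A k) * kron (\<pi> k g) (1\<^sub>m (m k)) = kron (\<pi> k g) (1\<^sub>m (m k)) * kron (1\<^sub>m (d k)) (A k)"
      using assms k pi_carrier[OF k g] left_mult_one_mat[of "A k" "m k" "m k"]
        right_mult_one_mat[of "A k" "m k" "m k"]
      by (simp add: kron_mult[of _ "d k" "d k" _ "m k" "m k" _ "d k" _ "m k"])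
    then show "sandwich k (kron (1\<^sub>m (d k)) (A k)) * \<rho> g = \<rho> g * sandwich k (kron (1\<^sub>m (d k)) (A k))"
      unfolding rho_eq[OF g] using K[OF k] k kron_pi_carrier[OF _ g] by (simp only: sandwich_mult_msum)
  qed
  also have "\<dots> = \<rho> g * bop A"
    unfolding bop_eq using K by (intro mult_msum[symmetric] sandwich_carrier rho_carrier g)
  finally show "bop A * \<rho> g = \<rho> g * bop A" .
qed (rule bop_carrier)

text \<open>Read off from the block diagonal form \<open>rho_eq\<close>: multiply by the projector
  onto the block and cancel the isometry \<open>J k\<close>.\<close>

lemma J_adj_rho:
  assumes k: "k < N" and g: "g \<in> carrier G"
  shows "adj (J k) * \<rho> g = kron (\<pi> k g) (1\<^sub>m (m k)) * adj (J k)"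
proof -
  let ?K = "kron (\<pi> k g) (1\<^sub>m (m k))"
  have K: "?K \<in> carrier_mat (d k * m k) (d k * m k)" using kron_pi_carrier[OF k g] .
  have "sandwich k (1\<^sub>m (d k * m k)) * \<rho> g = sandwich k (1\<^sub>m (d k * m k) * ?K)"
    unfolding rho_eq[OF g] using k kron_pi_carrier[OF _ g] by (intro sandwich_mult_msum) auto
  then have eq: "J k * (adj (J k) * \<rho> g) = J k * (?K * adj (J k))"
    using K k rho_carrier[OF g] by (simp add: mat_mult_assoc J_carrier J_adj_eq_sandwich[symmetric])
  have "adj (J k) * \<rho> g = adj (J k) * (J k * (adj (J k) * \<rho> g))"
    using k by (simp add: J_cancel)
  also have "\<dots> = ?K * adj (J k)" unfolding eq using k K by (simp add: J_cancel)
  finally show ?thesis .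
qed

text \<open>The corner \<open>T k l\<close> of \<open>A\<close> intertwines multiples of
  \<open>\<pi> l\<close> and \<open>\<pi> k\<close>. Inequivalence removes the corners with
  \<open>k\<close> different from \<open>l\<close>, the diagonal ones have the form
  \<open>kron (1\<^sub>m (d k)) (M k)\<close>, and resolutions of the identity on both sides of
  \<open>A\<close> reassemble it.\<close>

lemma commutant_bop:
  assumes A: "A \<in> commutant G n \<rho>"
  shows "\<exists>M. block_family M \<and> A = bop M"
proof -
  have Ac: "A \<in> carrier_mat n n" and comm: "\<And>g. g \<in> carrier G \<Longrightarrow> A * \<rho> g = \<rho> g * A"
    using A by (auto simp: commutant_def)
  define T where "T k l = adj (J k) * A * J l" for k l
  have T: "T k l \<in> carrier_mat (d k * m k) (d l * m l)" if "k < N" "l < N" for k l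
    using that by (auto simp: T_def intro!: carrier_matI)
  have int: "T k l * kron (\<pi> l g) (1\<^sub>m (m l)) = kron (\<pi> k g) (1\<^sub>m (m k)) * T k l"
    if k: "k < N" and l: "l < N" and g: "g \<in> carrier G" for k l g
  proof -
    have "T k l * kron (\<pi> l g) (1\<^sub>m (m l)) = adj (J k) * A * (J l * kron (\<pi> l g) (1\<^sub>m (m l)))"
      using that Ac kron_pi_carrier[OF l g] by (simp add: T_def mat_mult_assoc)
    also have "\<dots> = adj (J k) * (A * \<rho> g) * J l"
      using that Ac rho_carrier[OF g] by (simp add: rho_J[OF l g, symmetric] mat_mult_assoc)
    also have "\<dots> = adj (J k) * \<rho> g * A * J l"
      using that Ac rho_carrier[OF g] by (simp add: comm[OF g] mat_mult_assoc)
    also have "\<dots> = kron (\<pi> k g) (1\<^sub>m (m k)) * T k l"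
      using that Ac kron_pi_carrier[OF k g] by (simp add: J_adj_rho[OF k g] T_def mat_mult_assoc)
    finally show ?thesis .
  qed
  have off: "T k l = 0\<^sub>m (d k * m k) (d l * m l)" if k: "k < N" and l: "l < N" and "k \<noteq> l" for k l
    using inequivalent[OF l k] that int[OF k l] T[OF k l]
    by (intro tensor_intertwiner_inequivalent[OF irr[OF l] irr[OF k]]) auto
  have "\<exists>M\<in>carrier_mat (m k) (m k). T k k = kron (1\<^sub>m (d k)) M" if k: "k < N" for k
    using int[OF k k] T[OF k k] by (intro tensor_intertwiner_self[OF irr[OF k]]) auto
  then obtain M where M: "\<And>k. k < N \<Longrightarrow> M k \<in> carrier_mat (m k) (m k)"
      "\<And>k. k < N \<Longrightarrow> T k k = kron (1\<^sub>m (d k)) (M k)"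
    by metis
  have corner: "sandwich k (1\<^sub>m (d k * m k)) * A * sandwich l (1\<^sub>m (d l * m l)) = J k * T k l * adj (J l)"
    if k: "k < N" and l: "l < N" for k l
    using that Ac by (simp add: J_adj_eq_sandwich[symmetric] T_def mat_mult_assoc)
  let ?I = "\<lambda>k. sandwich k (1\<^sub>m (d k * m k))"
  have I: "?I k \<in> carrier_mat n n" if "k < N" for k
    using sandwich_carrier[OF that, of "1\<^sub>m (d k * m k)"] by simp
  have "A = msum n N ?I * A" using Ac by (simp add: sandwich_one_complete)
  also have "\<dots> = msum n N (\<lambda>k. ?I k * A)" using Ac I by (intro msum_mult)
  also have "\<dots> = bop M"
    unfolding bop_eq
  proof (rule msum_cong)
    fix k assume k: "k < N"
    have IA: "?I k * A \<in> carrier_mat n n" using I[OF k] Ac by (rule mult_carrier_mat)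
    have "?I k * A = ?I k * A * msum n N ?I" unfolding sandwich_one_complete using IA by (rule right_mult_one_mat[symmetric])
    also have "\<dots> = msum n N (\<lambda>l. ?I k * A * ?I l)" using IA I by (intro mult_msum)
    also have "\<dots> = ?I k * A * ?I k"
    proof (rule msum_single[where F = "\<lambda>l. ?I k * A * ?I l", OF k mult_carrier_mat[OF IA I[OF k]]])
      fix l assume l: "l < N" "l \<noteq> k"
      show "?I k * A * ?I l = 0\<^sub>m n n"
        unfolding corner[OF k l(1)] off[OF k l(1) l(2)[symmetric]] using k l by simp
    qed
    finally show "?I k * A = sandwich k (kron (1\<^sub>m (d k)) (M k))"
      using corner[OF k k] M(2)[OF k] by simp
  qed
  finally show ?thesis using M by auto
qed

end

section \<open>Positive operators and operators on a range\<close>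

text \<open>\<open>E\<close> embeds the \<open>m\<close>-dimensional space as its first copy,
  sending v to e_0 tensor v, which is possible because \<open>d\<close> is nonzero. Compressing by
  \<open>E\<close> leaves \<open>M\<close>.\<close>

lemma psd_kron_oneD:
  assumes psd: "psd (d * m) (kron (1\<^sub>m d) M)" and M: "M \<in> carrier_mat m m" and d: "d \<noteq> 0"
  shows "psd m M"
proof -
  define E :: "complex mat" where "E = mat (d * m) m (\<lambda>(i,b). if i = b then 1 else 0)"
  have E: "E \<in> carrier_mat (d * m) m" by (simp add: E_def)
  have K: "kron (1\<^sub>m d) M \<in> carrier_mat (d * m) (d * m)" using M by auto
  have "adj E * kron (1\<^sub>m d) M * E = M"
  proof (rule eq_matI)
    fix a b assume "a < dim_row M" "b < dim_col M"
    then have ab: "a < m" "b < m" using M by auto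
    have le: "m \<le> d * m" using d by simp
    have lt: "a < d * m" "b < d * m" using ab le by linarith+
    have "(adj E * kron (1\<^sub>m d) M * E) $$ (a,b)
        = (\<Sum>i<d * m. \<Sum>j<d * m. adj E $$ (a,i) * kron (1\<^sub>m d) M $$ (i,j) * E $$ (j,b))"
      by (rule mat_mult3_index[OF adj_carrier[OF E] K E ab])
    also have "\<dots> = (\<Sum>i<d * m. \<Sum>j<d * m. if j = b then if i = a then kron (1\<^sub>m d) M $$ (a,b) else 0 else 0)"
      using ab by (intro sum.cong refl) (simp add: E_def)
    also have "\<dots> = kron (1\<^sub>m d) M $$ (a,b)" using lt by simp
    also have "\<dots> = M $$ (a,b)" using M d ab lt by (subst kron_index[of _ d d _ m m]) auto
    finally show "(adj E * kron (1\<^sub>m d) M * E) $$ (a,b) = M $$ (a,b)" .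
  qed (use M E in auto)
  then show ?thesis using psd_compress[OF psd E] by simp
qed

text \<open>By Cholesky, \<open>V\<^sup>\<dagger> A V\<close> is a positive combination of two Gram matrices, whose traces vanish.\<close>

lemma psd_convex_kernel:
  assumes psd: "psd n A1" "psd n A2" and t: "0 < t" "t < 1" and V: "V \<in> carrier_mat n n"
    and zero: "adj V * (complex_of_real t \<cdot>\<^sub>m A1 + complex_of_real (1 - t) \<cdot>\<^sub>m A2) * V = 0\<^sub>m n n"
  shows "A1 * V = 0\<^sub>m n n" "A2 * V = 0\<^sub>m n n"
proof -
  obtain Y1 Y2 where Y: "Y1 \<in> carrier_mat n n" "Y2 \<in> carrier_mat n n"
    and A: "A1 = adj Y1 * Y1" "A2 = adj Y2 * Y2"
    using psd_factor[OF psd(1)] psd_factor[OF psd(2)] by auto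
  have c: "adj V \<in> carrier_mat n n" "complex_of_real t \<cdot>\<^sub>m A1 \<in> carrier_mat n n"
    "complex_of_real (1 - t) \<cdot>\<^sub>m A2 \<in> carrier_mat n n"
    using V Y A by auto
  have YV: "Y1 * V \<in> carrier_mat n n" "Y2 * V \<in> carrier_mat n n" using Y V by auto
  have G: "adj V * (s \<cdot>\<^sub>m (adj Y * Y)) * V = s \<cdot>\<^sub>m (adj (Y * V) * (Y * V))"
    if "Y \<in> carrier_mat n n" for Y s
    using that V by (simp add: mat_mult_smult mat_mult_adj mat_mult_assoc)
  have "adj V * (complex_of_real t \<cdot>\<^sub>m A1 + complex_of_real (1 - t) \<cdot>\<^sub>m A2) * V
      = complex_of_real t \<cdot>\<^sub>m (adj (Y1 * V) * (Y1 * V)) + complex_of_real (1 - t) \<cdot>\<^sub>m (adj (Y2 * V) * (Y2 * V))"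
    using add_mult_distrib_mat[OF mult_carrier_mat[OF c(1,2)] mult_carrier_mat[OF c(1,3)] V]
    unfolding mult_add_distrib_mat[OF c] unfolding A G[OF Y(1)] G[OF Y(2)] by simp
  then have "complex_of_real t * mtrace (adj (Y1 * V) * (Y1 * V))
      + complex_of_real (1 - t) * mtrace (adj (Y2 * V) * (Y2 * V)) = mtrace (0\<^sub>m n n)"
    using mult_carrier_mat[OF adj_carrier[OF YV(1)] YV(1)] mult_carrier_mat[OF adj_carrier[OF YV(2)] YV(2)]
    unfolding zero by (simp add: mtrace_add[of _ n] mtrace_smult[of _ n])
  moreover define s1 where "s1 = (\<Sum>j<n. \<Sum>i<n. (cmod ((Y1 * V) $$ (i,j)))\<^sup>2)"
  moreover define s2 where "s2 = (\<Sum>j<n. \<Sum>i<n. (cmod ((Y2 * V) $$ (i,j)))\<^sup>2)"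
  ultimately have "complex_of_real (t * s1 + (1 - t) * s2) = 0"
    unfolding mtrace_adj_mult[OF YV(1)] mtrace_adj_mult[OF YV(2)] by (simp add: mtrace_def)
  then have "t * s1 + (1 - t) * s2 = 0" by (simp only: of_real_eq_0_iff)
  moreover have nn: "s1 \<ge> 0" "s2 \<ge> 0" unfolding s1_def s2_def by (intro sum_nonneg; simp)+
  ultimately have "t * s1 = 0" "(1 - t) * s2 = 0"
    using t by (simp_all add: add_nonneg_eq_0_iff)
  then have "s1 = 0" "s2 = 0" using t by auto
  then have Z: "Y1 * V = 0\<^sub>m n n" "Y2 * V = 0\<^sub>m n n"
    using mtrace_adj_mult_eq_0_iff[OF YV(1)] mtrace_adj_mult_eq_0_iff[OF YV(2)]
    unfolding mtrace_adj_mult[OF YV(1)] mtrace_adj_mult[OF YV(2)] s1_def s2_def by auto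
  show "A1 * V = 0\<^sub>m n n" "A2 * V = 0\<^sub>m n n"
    using Y V Z by (simp_all add: A mat_mult_assoc)
qed

text \<open>The sum of the moduli of the entries bounds the form of \<open>A\<close>: each product
  of two coordinate moduli is at most the mean of their squares, hence at most the squared norm
  \<open>S\<close> of the vector.\<close>

lemma psd_one_plus_small:
  assumes A: "A \<in> carrier_mat n n" and herm: "adj A = A"
    and s: "\<bar>s\<bar> * (\<Sum>i<n. \<Sum>j<n. cmod (A $$ (i,j))) \<le> 1"
  shows "psd n (1\<^sub>m n + complex_of_real s \<cdot>\<^sub>m A)"
proof -
  have pos: "0 \<le> conjugate v \<bullet> ((1\<^sub>m n + complex_of_real s \<cdot>\<^sub>m A) *\<^sub>v v)" if v: "v \<in> carrier_vec n" for v
  proof -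
    define q where "q = (\<Sum>i<n. \<Sum>j<n. cnj (v $ i) * A $$ (i,j) * v $ j)"
    define S where "S = (\<Sum>i<n. (cmod (v $ i))\<^sup>2)"
    have "(\<Sum>i<n. cnj (v $ i) * v $ i) = of_real S"
      unfolding S_def of_real_sum complex_norm_square by (simp add: mult.commute)
    moreover have "(\<Sum>i<n. \<Sum>j<n. cnj (v $ i) * (1\<^sub>m n + complex_of_real s \<cdot>\<^sub>m A) $$ (i,j) * v $ j)
        = (\<Sum>i<n. \<Sum>j<n. (if j = i then cnj (v $ i) * v $ i else 0)
             + of_real s * (cnj (v $ i) * A $$ (i,j) * v $ j))"
      using A by (intro sum.cong refl) (auto simp: algebra_simps)
    ultimately have form: "conjugate v \<bullet> ((1\<^sub>m n + complex_of_real s \<cdot>\<^sub>m A) *\<^sub>v v) = of_real S + of_real s * q"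
      using A v by (subst quadratic_form_sum[of _ n]) (simp_all add: sum.distrib q_def sum_distrib_left)
    \<comment> \<open>The order on complex numbers requires equal imaginary parts, so the form has
      to be shown real; this is where hermiticity enters.\<close>
    have "cnj q = (\<Sum>i<n. \<Sum>j<n. cnj (v $ j) * A $$ (j,i) * v $ i)"
      unfolding q_def cnj_sum
    proof (intro sum.cong refl)
      fix i j assume "i \<in> {..<n}" "j \<in> {..<n}"
      then have "cnj (A $$ (i,j)) = A $$ (j,i)" using A adj_index[of j A i] unfolding herm by auto
      then show "cnj (cnj (v $ i) * A $$ (i,j) * v $ j) = cnj (v $ j) * A $$ (j,i) * v $ i" by simp
    qed
    also have "\<dots> = q" unfolding q_def by (rule sum.swap)
    finally have im: "Im q = 0" by (simp add: complex_eq_iff)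
    have sq: "(cmod (v $ i))\<^sup>2 \<le> S" if "i < n" for i
      unfolding S_def using that by (intro member_le_sum) auto
    have "cmod q \<le> (\<Sum>i<n. \<Sum>j<n. cmod (cnj (v $ i) * A $$ (i,j) * v $ j))"
      unfolding q_def by (intro sum_norm_le) (auto intro: sum_norm_le)
    also have "\<dots> \<le> (\<Sum>i<n. \<Sum>j<n. cmod (A $$ (i,j)) * S)"
    proof (intro sum_mono)
      fix i j assume "i \<in> {..<n}" "j \<in> {..<n}"
      then have "2 * (cmod (v $ i) * cmod (v $ j)) \<le> 2 * S"
        using sq[of i] sq[of j] sum_squares_bound[of "cmod (v $ i)" "cmod (v $ j)"] by simp
      then have "cmod (A $$ (i,j)) * (cmod (v $ i) * cmod (v $ j)) \<le> cmod (A $$ (i,j)) * S"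
        by (intro mult_left_mono) auto
      then show "cmod (cnj (v $ i) * A $$ (i,j) * v $ j) \<le> cmod (A $$ (i,j)) * S"
        by (simp add: norm_mult mult_ac)
    qed
    also have "\<dots> = (\<Sum>i<n. \<Sum>j<n. cmod (A $$ (i,j))) * S" by (simp add: sum_distrib_right)
    finally have "\<bar>s\<bar> * cmod q \<le> \<bar>s\<bar> * ((\<Sum>i<n. \<Sum>j<n. cmod (A $$ (i,j))) * S)"
      by (intro mult_left_mono) auto
    also have "\<dots> \<le> 1 * S"
      unfolding mult.assoc[symmetric] using s by (intro mult_right_mono) (auto simp: S_def sum_nonneg)
    finally have "\<bar>s * Re q\<bar> \<le> S"
      using mult_left_mono[OF abs_Re_le_cmod[of q], of "\<bar>s\<bar>"] by (simp add: abs_mult)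
    then show ?thesis unfolding form by (simp add: less_eq_complex_def im)
  qed
  have "adj (1\<^sub>m n + complex_of_real s \<cdot>\<^sub>m A) = 1\<^sub>m n + complex_of_real s \<cdot>\<^sub>m A"
    using A adj_add[of "1\<^sub>m n" n n "complex_of_real s \<cdot>\<^sub>m A"] by (simp add: adj_smult herm)
  then show ?thesis using A pos by (simp add: psd_def)
qed

section \<open>Operators living on the range of a matrix\<close>

lemma ops_on_adj:
  "B \<in> ops_on n S \<Longrightarrow> adj B \<in> ops_on n S"
  by (auto simp: ops_on_def)

lemma ops_on_rng_add:
  assumes X: "X \<in> carrier_mat n m" and "A \<in> ops_on n (rng X)" "B \<in> ops_on n (rng X)"
  shows "A + B \<in> ops_on n (rng X)"
proof -
  obtain Z where Z: "Z \<in> carrier_mat m n" "adj (X * Z) = X * Z" "X * Z * X = X"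
    using range_projector[OF X] by auto
  have P: "X * Z \<in> carrier_mat n n" using X Z(1) by auto
  note iff = ops_on_rng_iff[OF X Z]
  show ?thesis
    using assms(2,3) mult_add_distrib_mat[OF P, of A n B] add_mult_distrib_mat[of A n n B, OF _ _ P]
    unfolding iff by simp
qed

lemma ops_on_rng_smult:
  assumes X: "X \<in> carrier_mat n m" and "A \<in> ops_on n (rng X)"
  shows "c \<cdot>\<^sub>m A \<in> ops_on n (rng X)"
proof -
  obtain Z where Z: "Z \<in> carrier_mat m n" "adj (X * Z) = X * Z" "X * Z * X = X"
    using range_projector[OF X] by auto
  have P: "X * Z \<in> carrier_mat n n" using X Z(1) by auto
  note iff = ops_on_rng_iff[OF X Z]
  have A: "A \<in> carrier_mat n n" "X * Z * A = A" "A * (X * Z) = A"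
    using assms(2) unfolding iff by auto
  have "X * Z * (c \<cdot>\<^sub>m A) = c \<cdot>\<^sub>m A"
    using A mat_mult_smult(1)[of "X * Z" A c] P X Z by simp
  moreover have "(c \<cdot>\<^sub>m A) * (X * Z) = c \<cdot>\<^sub>m A"
    using A mat_mult_smult(2)[of A "X * Z" c] P X Z by simp
  ultimately show ?thesis using A unfolding iff by simp
qed

text \<open>Shows that the values of the surjectivity map lie in B(Rng X_k), so that least-squares
  residuals stay there.\<close>

lemma ops_on_rng_sandwich:
  assumes X: "X \<in> carrier_mat n m" and A: "A \<in> carrier_mat m m"
  shows "X * A * adj X \<in> ops_on n (rng X)"
proof -
  obtain Z where Z: "Z \<in> carrier_mat m n" "adj (X * Z) = X * Z" "X * Z * X = X"
    using range_projector[OF X] by auto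
  have P: "X * Z \<in> carrier_mat n n" using X Z(1) by auto
  have "X * Z * (X * A * adj X) = X * Z * X * (A * adj X)"
    using X A Z(1) by (simp add: mat_mult_assoc)
  also have "\<dots> = X * A * adj X" unfolding Z(3) using X A by (simp add: mat_mult_assoc)
  finally have 1: "X * Z * (X * A * adj X) = X * A * adj X" .
  have "adj (X * Z * X) = adj X * (X * Z)"
    using adj_mult[OF P X] Z(2) by simp
  then have "adj X * (X * Z) = adj X" unfolding Z(3) by simp
  then have 2: "X * A * adj X * (X * Z) = X * A * adj X"
    using X A Z(1) by (simp add: mat_mult_assoc)
  show ?thesis unfolding ops_on_rng_iff[OF X Z] using 1 2 X A by auto
qed

text \<open>Conjugation by \<open>X\<close> loses nothing on B(Rng X): absorption gives
  \<open>A = adj Z * (adj X * A * X) * Z\<close>.\<close>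

lemma ops_on_rng_compress_zero:
  assumes X: "X \<in> carrier_mat n m" and A: "A \<in> ops_on n (rng X)" and zero: "adj X * A * X = 0\<^sub>m m m"
  shows "A = 0\<^sub>m n n"
proof -
  obtain Z where Z: "Z \<in> carrier_mat m n" "adj (X * Z) = X * Z" "X * Z * X = X"
    using range_projector[OF X] by auto
  have Ac: "A \<in> carrier_mat n n" and e: "X * Z * A = A" "A * (X * Z) = A"
    using A unfolding ops_on_rng_iff[OF X Z] by auto
  have "A = adj (X * Z) * A * (X * Z)" unfolding Z(2) e ..
  also have "\<dots> = adj Z * (adj X * A * X) * Z"
    using X Z(1) Ac by (simp add: mat_mult_adj mat_mult_assoc)
  also have "\<dots> = 0\<^sub>m n n" unfolding zero using Z(1) by simp
  finally show ?thesis .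
qed

text \<open>With \<open>Q = X\<^sup>\<dagger> W\<close> the orthogonal projector onto the support of \<open>X\<close>, the hypothesis on kernels
  gives \<open>D = Q D Q\<close>, that is \<open>D = X\<^sup>\<dagger> (W D W\<^sup>\<dagger>) X\<close>; compressing the inner factor with the range
  projector \<open>X Z\<close> does not change this.\<close>

lemma hermitian_factor_through:
  assumes X: "X \<in> carrier_mat n n" and Z: "Z \<in> carrier_mat n n" and W: "W \<in> carrier_mat n n"
    and P: "adj (X * Z) = X * Z" "X * Z * X = X"
    and Q: "adj (adj X * W) = adj X * W" "adj X * W * adj X = adj X"
    and D: "D \<in> carrier_mat n n" "adj D = D"
    and ker: "\<And>V. V \<in> carrier_mat n n \<Longrightarrow> X * V = 0\<^sub>m n n \<Longrightarrow> D * V = 0\<^sub>m n n"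
  shows "X * Z * (W * D * adj W) * (X * Z) \<in> ops_on n (rng X)"
    and "adj X * (X * Z * (W * D * adj W) * (X * Z)) * X = D"
proof -
  let ?P = "X * Z" and ?Q = "adj X * W" and ?I = "W * D * adj W"
  have Pc: "?P \<in> carrier_mat n n" and Qc: "?Q \<in> carrier_mat n n" and Ic: "?I \<in> carrier_mat n n"
    using X Z W D by auto
  have PP: "?P * ?P = ?P"
    using X Z assoc_mult_mat[OF Pc X Z] P(2) by simp
  have 1: "?P * (?P * ?I * ?P) = ?P * ?I * ?P"
  proof -
    have "?P * (?P * ?I * ?P) = ?P * ?P * (?I * ?P)"
      using Pc Ic by (simp add: assoc_mult_mat[of _ n n _ n _ n])
    then show ?thesis unfolding PP using Pc Ic by (simp add: assoc_mult_mat[of _ n n _ n _ n])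
  qed
  have 2: "?P * ?I * ?P * ?P = ?P * ?I * ?P"
    using assoc_mult_mat[OF mult_carrier_mat[OF Pc Ic] Pc Pc] unfolding PP .
  show "?P * ?I * ?P \<in> ops_on n (rng X)"
    unfolding ops_on_rng_iff[OF X Z P] using 1 2 mult_carrier_mat[OF mult_carrier_mat[OF Pc Ic] Pc] by simp
  have XP: "adj X * ?P = adj X" using adj_mult[OF Pc X] P by simp
  have XQ: "X * ?Q = X" using adj_mult[OF Qc adj_carrier[OF X]] Q by simp
  \<comment> \<open>The columns of \<open>1\<^sub>m n - ?Q\<close> lie in the kernel of
    \<open>X\<close>, so \<open>ker\<close> yields \<open>D * ?Q = D\<close>; since \<open>D\<close>
    and \<open>?Q\<close> are hermitian, \<open>?Q * D = D\<close> follows.\<close>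
  have "X * (1\<^sub>m n - ?Q) = 0\<^sub>m n n"
    using mult_minus_distrib_mat[OF X one_carrier_mat Qc] X XQ by simp
  then have "D * (1\<^sub>m n - ?Q) = 0\<^sub>m n n" by (rule ker[OF minus_carrier_mat[OF Qc]])
  then have eq: "D - D * ?Q = 0\<^sub>m n n"
    using mult_minus_distrib_mat[OF D(1) one_carrier_mat Qc] D by simp
  have DQ: "D * ?Q = D"
  proof (rule eq_matI)
    fix i j assume "i < dim_row D" "j < dim_col D"
    then show "(D * ?Q) $$ (i,j) = D $$ (i,j)"
      using arg_cong[OF eq, of "\<lambda>M. M $$ (i,j)"] D X W by (simp del: index_mult_mat(1))
  qed (use D X W in auto)
  have QD: "?Q * D = D" using adj_mult[OF D(1) Qc] DQ D Q by simp
  have "adj X * (?P * ?I * ?P) * X = adj X * ?P * ?I * (?P * X)"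
    using X Z W D by (simp add: mat_mult_assoc)
  also have "\<dots> = adj X * ?I * X" unfolding XP P(2) ..
  also have "\<dots> = ?Q * (D * adj ?Q)"
    using X W D by (simp add: mat_mult_assoc mat_mult_adj)
  also have "\<dots> = D" unfolding Q(1) DQ QD ..
  finally show "adj X * (?P * ?I * ?P) * X = D" .
qed

section \<open>Extremality, injectivity and surjectivity\<close>

context isotypic
begin

lemma bop_zero: "bop (\<lambda>k. 0\<^sub>m (m k) (m k)) = 0\<^sub>m n n"
proof -
  have "sandwich k (kron (1\<^sub>m (d k)) (0\<^sub>m (m k) (m k))) = 0\<^sub>m n n" if k: "k < N" for k
  proof -
    have "kron (1\<^sub>m (d k)) (0\<^sub>m (m k) (m k)) = (0\<^sub>m (d k * m k) (d k * m k) :: complex mat)"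
      by (rule eq_matI) (auto simp: kron_def div_mod_less_mult)
    then show ?thesis using k by simp
  qed
  then have "bop (\<lambda>k. 0\<^sub>m (m k) (m k)) = msum n N (\<lambda>k. 0\<^sub>m n n)"
    unfolding bop_eq by (rule msum_cong)
  also have "\<dots> = 0\<^sub>m n n" by (rule eq_matI) auto
  finally show ?thesis .
qed

lemma block_family_mult:
  assumes "block_family A" "block_family B"
  shows "block_family (\<lambda>k. A k * B k)"
  using assms mult_carrier_mat by blast

text \<open>Applying \<open>range_projector\<close> to each block, and not to \<open>bop X\<close>
  as a whole, provides a \<open>bop Z\<close> in the commutant and relates the global projector to
  those of the blocks.\<close>

lemma block_projectors:
  assumes X: "block_family X"
  obtains Z where "block_family Z"
    and "\<And>k. k < N \<Longrightarrow> adj (X k * Z k) = X k * Z k" "\<And>k. k < N \<Longrightarrow> X k * Z k * X k = X k"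
    and "adj (bop X * bop Z) = bop X * bop Z" "bop X * bop Z * bop X = bop X"
proof -
  have "\<forall>k. k < N \<longrightarrow> (\<exists>Z\<in>carrier_mat (m k) (m k). adj (X k * Z) = X k * Z \<and> X k * Z * X k = X k)"
    using X range_projector by blast
  then obtain Z where Z: "\<And>k. k < N \<Longrightarrow> Z k \<in> carrier_mat (m k) (m k)"
      "\<And>k. k < N \<Longrightarrow> adj (X k * Z k) = X k * Z k" "\<And>k. k < N \<Longrightarrow> X k * Z k * X k = X k"
    by metis
  then have Zf: "block_family Z" and XZ: "block_family (\<lambda>k. X k * Z k)"
    using block_family_mult[OF X] by simp_all
  have "adj (bop X * bop Z) = bop X * bop Z"
    unfolding bop_mult[OF X Zf] adj_bop[OF XZ] by (rule bop_cong) (rule Z)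
  moreover have "bop X * bop Z * bop X = bop X"
    unfolding bop_mult[OF X Zf] bop_mult[OF XZ X] by (rule bop_cong) (rule Z)
  ultimately show thesis using that Zf Z by blast
qed

lemma bop_projector:
  assumes "block_family X"
  shows "\<exists>Z. block_family Z \<and> adj (bop X * bop Z) = bop X * bop Z \<and> bop X * bop Z * bop X = bop X"
  by (rule block_projectors[OF assms]) blast

text \<open>The range projector of \<open>bop X\<close> is block diagonal, so the absorption
  equations can be compared block by block.\<close>

lemma bop_ops_on_iff:
  assumes X: "block_family X" and Y: "block_family Y"
  shows "bop Y \<in> ops_on n (rng (bop X)) \<longleftrightarrow> (\<forall>k<N. Y k \<in> ops_on (m k) (rng (X k)))"
proof -
  obtain Z where Z: "block_family Z"
    and p: "\<And>k. k < N \<Longrightarrow> adj (X k * Z k) = X k * Z k" "\<And>k. k < N \<Longrightarrow> X k * Z k * X k = X k"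
    and P: "adj (bop X * bop Z) = bop X * bop Z" "bop X * bop Z * bop X = bop X"
    using block_projectors[OF X] by blast
  note XZ = block_family_mult[OF X Z]
  note XZY = block_family_mult[OF XZ Y] and YXZ = block_family_mult[OF Y XZ]
  have "bop X * bop Z * bop Y = bop Y \<longleftrightarrow> (\<forall>k<N. X k * Z k * Y k = Y k)"
    unfolding bop_mult[OF X Z] bop_mult[OF XZ Y] bop_eq_iff[OF XZY Y] ..
  moreover have "bop Y * (bop X * bop Z) = bop Y \<longleftrightarrow> (\<forall>k<N. Y k * (X k * Z k) = Y k)"
    unfolding bop_mult[OF X Z] bop_mult[OF Y XZ] bop_eq_iff[OF YXZ Y] ..
  moreover have "Y k \<in> ops_on (m k) (rng (X k)) \<longleftrightarrow> X k * Z k * Y k = Y k \<and> Y k * (X k * Z k) = Y k"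
    if k: "k < N" for k
    using ops_on_rng_iff[OF X[rule_format, OF k] Z[rule_format, OF k] p(1)[OF k] p(2)[OF k]] Y k by simp
  ultimately show ?thesis
    unfolding ops_on_rng_iff[OF bop_carrier bop_carrier P] using bop_carrier by auto
qed

text \<open>Compressing by \<open>J k\<close> makes \<open>kron (1\<^sub>m (d k)) (M k)\<close>
  positive, hence also \<open>M k\<close>, so each block has a factor of its own and the assembled
  factor lies in the commutant.\<close>

lemma psd_commutant_factor:
  assumes R: "R \<in> commutant G n \<rho>" and psd: "psd n R"
  shows "\<exists>X. block_family X \<and> R = adj (bop X) * bop X"
proof -
  obtain M where M: "block_family M" "R = bop M" using commutant_bop[OF R] by auto
  have "\<exists>X\<in>carrier_mat (m k) (m k). M k = adj X * X" if k: "k < N" for k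
  proof -
    have "psd (d k * m k) (adj (J k) * R * J k)" by (rule psd_compress[OF psd J_carrier[OF k]])
    then have "psd (d k * m k) (kron (1\<^sub>m (d k)) (M k))"
      unfolding M(2) bop_compress[OF M(1) k] .
    then have "psd (m k) (M k)"
      by (rule psd_kron_oneD[OF _ M(1)[rule_format, OF k] d_nonzero[OF k]])
    then show ?thesis by (rule psd_factor)
  qed
  then obtain X where X: "\<And>k. k < N \<Longrightarrow> X k \<in> carrier_mat (m k) (m k)"
      "\<And>k. k < N \<Longrightarrow> M k = adj (X k) * X k" by metis
  then have Xf: "block_family X" "block_family (\<lambda>k. adj (X k))" by auto
  have "R = adj (bop X) * bop X"
    unfolding M(2) adj_bop[OF Xf(1)] bop_mult[OF Xf(2,1)] by (rule bop_cong) (rule X)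
  then show ?thesis using Xf by blast
qed

lemma adj_commutant:
  assumes "A \<in> commutant G n \<rho>"
  shows "adj A \<in> commutant G n \<rho>"
proof -
  obtain M where M: "block_family M" "A = bop M" using commutant_bop[OF assms] by auto
  show ?thesis unfolding M(2) adj_bop[OF M(1)] using M(1) by (intro bop_commutant) auto
qed

end

text \<open>Adds the tensor structure of the ambient space: \<open>a\<close> and \<open>b\<close>
  are the dimensions of K and H, so \<open>ptrace1 a b\<close> is the trace over K.\<close>

locale covariant_ops = isotypic +
  fixes a b :: nat and K0 :: "complex mat"
  assumes n_eq: "n = a * b"
begin

definition feasible :: "complex mat set" where
  "feasible = {R. R \<in> commutant G n \<rho> \<and> psd n R \<and> ptrace1 a b R = K0}"

definition injectivity :: "(nat \<Rightarrow> complex mat) \<Rightarrow> bool" where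
  "injectivity X \<longleftrightarrow> (\<forall>Ob. Ob \<in> commutant G n \<rho> \<and> Ob \<in> ops_on n (rng (bop X)) \<and>
     ptrace1 a b (adj (bop X) * Ob * bop X) = 0\<^sub>m b b \<longrightarrow> Ob = 0\<^sub>m n n)"

text \<open>The \<open>k\<close>-th component of the map in the surjectivity condition. Compression
  by the isometry \<open>J k\<close> expresses P_k (I tensor C) P_k as an operator on the
  \<open>k\<close>-th tensor product.\<close>

definition block_map :: "(nat \<Rightarrow> complex mat) \<Rightarrow> complex mat \<Rightarrow> nat \<Rightarrow> complex mat" where
  "block_map X C k = X k * ptrace1 (d k) (m k) (adj (J k) * kron (1\<^sub>m a) C * J k) * adj (X k)"

definition surjectivity :: "(nat \<Rightarrow> complex mat) \<Rightarrow> bool" where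
  "surjectivity X \<longleftrightarrow> (\<forall>Y. (\<forall>k\<in>{k. k < N \<and> X k \<noteq> 0\<^sub>m (m k) (m k)}. Y k \<in> ops_on (m k) (rng (X k))) \<longrightarrow>
     (\<exists>C\<in>carrier_mat b b. \<forall>k\<in>{k. k < N \<and> X k \<noteq> 0\<^sub>m (m k) (m k)}. Y k = block_map X C k))"

lemma feasible_carrier: "R \<in> feasible \<Longrightarrow> R \<in> carrier_mat n n"
  by (simp add: feasible_def commutant_def)

section \<open>Extremality and injectivity\<close>

lemma ptrace1_diff:
  assumes "A \<in> carrier_mat n n" "B \<in> carrier_mat n n"
  shows "ptrace1 a b (A + (-1) \<cdot>\<^sub>m B) = ptrace1 a b A + (-1) \<cdot>\<^sub>m ptrace1 a b B"
  using assms by (simp add: n_eq ptrace1_add ptrace1_smult)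

lemma extremal_if_injectivity:
  assumes X: "block_family X" and R: "R = adj (bop X) * bop X" "R \<in> feasible" and inj: "injectivity X"
  shows "extremal_in feasible R"
  unfolding extremal_in_def
proof (intro conjI R(2) ballI allI impI)
  fix R1 R2 t
  assume R1: "R1 \<in> feasible" and R2: "R2 \<in> feasible"
    and t: "0 < t \<and> t < 1 \<and> R = complex_of_real t \<cdot>\<^sub>m R1 + complex_of_real (1 - t) \<cdot>\<^sub>m R2"
  have c: "R1 \<in> carrier_mat n n" "R2 \<in> carrier_mat n n" using R1 R2 feasible_carrier by auto
  have psd: "psd n R1" "psd n R2" using R1 R2 by (auto simp: feasible_def)
  \<comment> \<open>The difference is written with the scalar -1, so that the closure lemmas for
    sums and scalar multiples apply.\<close>
  define D where "D = R1 + (-1) \<cdot>\<^sub>m R2"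
  have D: "D \<in> carrier_mat n n" using c by (simp add: D_def)
  have Dh: "adj D = D"
    using c psd adj_add[of R1 n n "(-1) \<cdot>\<^sub>m R2"] by (simp add: D_def adj_smult psd_def)
  have Dc: "D \<in> commutant G n \<rho>"
    unfolding D_def using R1 R2 rho_carrier
    by (intro commutant_add commutant_smult) (auto simp: feasible_def)
  \<comment> \<open>\<open>R\<close> has zero compression by any \<open>V\<close> with
    \<open>bop X * V = 0\<^sub>m n n\<close>, and then both positive parts of the convex combination
    annihilate \<open>V\<close>.\<close>
  have ker: "D * V = 0\<^sub>m n n" if V: "V \<in> carrier_mat n n" and XV: "bop X * V = 0\<^sub>m n n" for V
  proof -
    have "adj V * R * V = adj (bop X * V) * (bop X * V)"
      using V by (simp add: R(1) mat_mult_adj mat_mult_assoc)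
    then have "adj V * R * V = 0\<^sub>m n n" unfolding XV by simp
    then have "R1 * V = 0\<^sub>m n n" "R2 * V = 0\<^sub>m n n"
      using psd_convex_kernel[OF psd _ _ V] t by auto
    then show ?thesis
      using add_mult_distrib_mat[OF c(1) _ V, of "(-1) \<cdot>\<^sub>m R2"] c V
      by (simp add: D_def mat_mult_smult)
  qed
  have X': "block_family (\<lambda>k. adj (X k))" using X by auto
  obtain Z where Z: "block_family Z"
    and P: "adj (bop X * bop Z) = bop X * bop Z" "bop X * bop Z * bop X = bop X"
    using bop_projector[OF X] by (elim exE conjE) (rule that)
  \<comment> \<open>For the adjoint blocks the same lemma gives the projector onto the support of
    \<open>bop X\<close>, again built from block operators; this keeps \<open>Ob\<close> in the
    commutant.\<close>
  obtain W where W: "block_family W"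
    and Q: "adj (adj (bop X) * bop W) = adj (bop X) * bop W" "adj (bop X) * bop W * adj (bop X) = adj (bop X)"
    using bop_projector[OF X'] unfolding adj_bop[OF X, symmetric] by (elim exE conjE) (rule that)
  define Ob where "Ob = bop X * bop Z * (bop W * D * adj (bop W)) * (bop X * bop Z)"
  have ob: "Ob \<in> ops_on n (rng (bop X))" "adj (bop X) * Ob * bop X = D"
    unfolding Ob_def
    by (rule hermitian_factor_through[OF bop_carrier bop_carrier bop_carrier P Q D Dh ker]; assumption)+
  have "Ob \<in> commutant G n \<rho>"
    unfolding Ob_def using rho_carrier Dc X Z W
    by (intro commutant_mult adj_commutant bop_commutant) auto
  moreover have "ptrace1 a b D = 0\<^sub>m b b"
  proof -
    have "ptrace1 a b D = K0 + (-1) \<cdot>\<^sub>m K0"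
      unfolding D_def ptrace1_diff[OF c] using R1 R2 by (simp add: feasible_def)
    moreover have "K0 \<in> carrier_mat b b" using R1 by (auto simp: feasible_def)
    ultimately show ?thesis by (auto intro!: eq_matI)
  qed
  ultimately have "Ob = 0\<^sub>m n n" using inj ob unfolding injectivity_def by simp
  then have "D = 0\<^sub>m n n" using ob(2) by simp
  show "R1 = R2"
  proof (rule eq_matI)
    fix i j assume "i < dim_row R2" "j < dim_col R2"
    then show "R1 $$ (i,j) = R2 $$ (i,j)"
      using arg_cong[OF \<open>D = 0\<^sub>m n n\<close>, of "\<lambda>M. M $$ (i,j)"] c by (simp add: D_def)
  qed (use c in auto)
qed

text \<open>A hermitian \<open>O\<close> in the kernel would make \<open>X\<^sup>\<dagger>(1 \<plusminus> s O)X\<close> feasible for small \<open>s\<close>.\<close>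

lemma hermitian_zero_if_extremal:
  assumes X: "block_family X" and R: "R = adj (bop X) * bop X" and ext: "extremal_in feasible R"
    and A: "A \<in> commutant G n \<rho>" "A \<in> ops_on n (rng (bop X))" "adj A = A"
    and zero: "ptrace1 a b (adj (bop X) * A * bop X) = 0\<^sub>m b b"
  shows "A = 0\<^sub>m n n"
proof -
  let ?X = "bop X"
  have Ac: "A \<in> carrier_mat n n" using A(1) by (simp add: commutant_def)
  have RF: "R \<in> feasible" using ext by (simp add: extremal_in_def)
  define T where "T = adj ?X * A * ?X"
  have T: "T \<in> carrier_mat n n" using Ac by (intro carrier_matI) (auto simp: T_def)
  have Rc: "R \<in> carrier_mat n n" using RF by (rule feasible_carrier)
  define c where "c = (\<Sum>i<n. \<Sum>j<n. cmod (A $$ (i,j)))"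
  \<comment> \<open>The summand 1 keeps \<open>s\<close> positive also when \<open>c = 0\<close>,
    and \<open>s * c\<close> stays at most 1 as \<open>psd_one_plus_small\<close> demands.\<close>
  define s where "s = 1 / (c + 1)"
  have c0: "c \<ge> 0" unfolding c_def by (intro sum_nonneg) auto
  then have s0: "s > 0" and sc: "s * c \<le> 1" by (simp_all add: s_def field_simps)
  define Rs where "Rs r = R + complex_of_real r \<cdot>\<^sub>m T" for r
  have feas: "Rs r \<in> feasible" if r: "\<bar>r\<bar> = s" for r
  proof -
    have rA: "complex_of_real r \<cdot>\<^sub>m A \<in> carrier_mat n n" using Ac by simp
    have Xa: "adj ?X \<in> carrier_mat n n" using bop_carrier by auto
    have "adj ?X * (1\<^sub>m n + complex_of_real r \<cdot>\<^sub>m A) * ?X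
        = (adj ?X * 1\<^sub>m n + adj ?X * (complex_of_real r \<cdot>\<^sub>m A)) * ?X"
      unfolding mult_add_distrib_mat[OF Xa one_carrier_mat rA] ..
    also have "\<dots> = adj ?X * 1\<^sub>m n * ?X + adj ?X * (complex_of_real r \<cdot>\<^sub>m A) * ?X"
      by (rule add_mult_distrib_mat[OF mult_carrier_mat[OF Xa one_carrier_mat] mult_carrier_mat[OF Xa rA] bop_carrier])
    also have "\<dots> = Rs r"
      unfolding right_mult_one_mat[OF Xa] using Ac by (simp add: Rs_def R T_def mat_mult_smult)
    finally have eq: "adj ?X * (1\<^sub>m n + complex_of_real r \<cdot>\<^sub>m A) * ?X = Rs r" .
    have "psd n (1\<^sub>m n + complex_of_real r \<cdot>\<^sub>m A)"
      using Ac A(3) sc r by (intro psd_one_plus_small) (auto simp: c_def)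
    then have "psd n (Rs r)" unfolding eq[symmetric] by (rule psd_compress[OF _ bop_carrier])
    moreover have "Rs r \<in> commutant G n \<rho>"
      unfolding eq[symmetric] using rho_carrier A(1) X
      by (intro commutant_mult commutant_add commutant_smult commutant_one adj_commutant bop_commutant) auto
    moreover have "ptrace1 a b (Rs r) = K0"
    proof -
      have "ptrace1 a b (Rs r) = ptrace1 a b R + complex_of_real r \<cdot>\<^sub>m ptrace1 a b T"
        unfolding Rs_def using Rc T by (simp add: n_eq ptrace1_add ptrace1_smult)
      moreover have "ptrace1 a b R = K0" "K0 \<in> carrier_mat b b" using RF by (auto simp: feasible_def)
      ultimately show ?thesis using zero by (simp add: T_def)
    qed
    ultimately show ?thesis by (simp add: feasible_def)
  qed
  have "R = complex_of_real (1/2) \<cdot>\<^sub>m Rs s + complex_of_real (1 - 1/2) \<cdot>\<^sub>m Rs (- s)"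
  proof (rule eq_matI)
    fix i j
    assume "i < dim_row (complex_of_real (1/2) \<cdot>\<^sub>m Rs s + complex_of_real (1 - 1/2) \<cdot>\<^sub>m Rs (- s))"
      "j < dim_col (complex_of_real (1/2) \<cdot>\<^sub>m Rs s + complex_of_real (1 - 1/2) \<cdot>\<^sub>m Rs (- s))"
    then have ij: "i < n" "j < n" using Rc T by (auto simp: Rs_def)
    then show "R $$ (i,j) = (complex_of_real (1/2) \<cdot>\<^sub>m Rs s + complex_of_real (1 - 1/2) \<cdot>\<^sub>m Rs (- s)) $$ (i,j)"
      using Rc T by (simp add: Rs_def field_simps)
  qed (use Rc T in \<open>auto simp: Rs_def\<close>)
  moreover have "Rs s \<in> feasible" "Rs (- s) \<in> feasible" using feas s0 by auto
  moreover have "0 < (1/2::real) \<and> (1/2::real) < 1" by simp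
  ultimately have eq: "Rs s = Rs (- s)" using ext unfolding extremal_in_def by blast
  have "T = 0\<^sub>m n n"
  proof (rule eq_matI)
    fix i j assume "i < dim_row (0\<^sub>m n n :: complex mat)" "j < dim_col (0\<^sub>m n n :: complex mat)"
    then have ij: "i < n" "j < n" by auto
    have "complex_of_real s * T $$ (i,j) = - complex_of_real s * T $$ (i,j)"
      using arg_cong[OF eq, of "\<lambda>M. M $$ (i,j)"] ij Rc T by (simp add: Rs_def)
    then have "2 * complex_of_real s * T $$ (i,j) = 0" by (simp add: algebra_simps)
    then show "T $$ (i,j) = 0\<^sub>m n n $$ (i,j)" using s0 ij by simp
  qed (use T in auto)
  then show ?thesis using ops_on_rng_compress_zero[OF bop_carrier A(2)] by (simp add: T_def)
qed

lemma injectivity_if_extremal: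
  assumes X: "block_family X" and R: "R = adj (bop X) * bop X" and ext: "extremal_in feasible R"
  shows "injectivity X"
  unfolding injectivity_def
proof (intro allI impI)
  fix A assume A: "A \<in> commutant G n \<rho> \<and> A \<in> ops_on n (rng (bop X)) \<and>
     ptrace1 a b (adj (bop X) * A * bop X) = 0\<^sub>m b b"
  let ?X = "bop X"
  have Ac: "A \<in> carrier_mat n n" using A by (simp add: commutant_def)
  have A': "adj A \<in> commutant G n \<rho>" "adj A \<in> ops_on n (rng ?X)" "adj A \<in> carrier_mat n n"
    using A Ac adj_commutant ops_on_adj by auto
  have Xa: "adj ?X \<in> carrier_mat n n" using bop_carrier by auto
  have T: "adj ?X * A * ?X \<in> carrier_mat n n" using Ac by (intro carrier_matI) auto
  have "adj ?X * adj A * ?X = adj (adj ?X * A * ?X)"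
    using Ac by (simp add: mat_mult_adj mat_mult_assoc)
  then have "ptrace1 a b (adj ?X * adj A * ?X) = adj (ptrace1 a b (adj ?X * A * ?X))"
    using T by (simp add: n_eq ptrace1_adj)
  then have zero': "ptrace1 a b (adj ?X * adj A * ?X) = 0\<^sub>m b b" using A by simp
  have comb: "ptrace1 a b (adj ?X * (x \<cdot>\<^sub>m A + y \<cdot>\<^sub>m adj A) * ?X) = 0\<^sub>m b b"
    "x \<cdot>\<^sub>m A + y \<cdot>\<^sub>m adj A \<in> commutant G n \<rho>" "x \<cdot>\<^sub>m A + y \<cdot>\<^sub>m adj A \<in> ops_on n (rng ?X)" for x y
  proof -
    have c: "x \<cdot>\<^sub>m A \<in> carrier_mat n n" "y \<cdot>\<^sub>m adj A \<in> carrier_mat n n" using Ac A' by auto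
    have T': "adj ?X * adj A * ?X \<in> carrier_mat n n" using Ac by (intro carrier_matI) auto
    have "adj ?X * (x \<cdot>\<^sub>m A + y \<cdot>\<^sub>m adj A) * ?X = adj ?X * (x \<cdot>\<^sub>m A) * ?X + adj ?X * (y \<cdot>\<^sub>m adj A) * ?X"
      unfolding mult_add_distrib_mat[OF Xa c]
      by (rule add_mult_distrib_mat[OF mult_carrier_mat[OF Xa c(1)] mult_carrier_mat[OF Xa c(2)] bop_carrier])
    also have "\<dots> = x \<cdot>\<^sub>m (adj ?X * A * ?X) + y \<cdot>\<^sub>m (adj ?X * adj A * ?X)"
      using Ac by (simp add: mat_mult_smult)
    finally show "ptrace1 a b (adj ?X * (x \<cdot>\<^sub>m A + y \<cdot>\<^sub>m adj A) * ?X) = 0\<^sub>m b b"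
      using T T' A zero' by (simp add: n_eq ptrace1_add ptrace1_smult)
    show "x \<cdot>\<^sub>m A + y \<cdot>\<^sub>m adj A \<in> commutant G n \<rho>"
      using A A' rho_carrier by (intro commutant_add commutant_smult) auto
    show "x \<cdot>\<^sub>m A + y \<cdot>\<^sub>m adj A \<in> ops_on n (rng ?X)"
      using A A' bop_carrier by (intro ops_on_rng_add ops_on_rng_smult) auto
  qed
  have "adj (1 \<cdot>\<^sub>m A + 1 \<cdot>\<^sub>m adj A) = 1 \<cdot>\<^sub>m A + 1 \<cdot>\<^sub>m adj A"
    using Ac by (intro eq_matI) auto
  then have re: "1 \<cdot>\<^sub>m A + 1 \<cdot>\<^sub>m adj A = 0\<^sub>m n n"
    using hermitian_zero_if_extremal[OF X R ext] comb by blast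
  have "adj (\<i> \<cdot>\<^sub>m A + (-\<i>) \<cdot>\<^sub>m adj A) = \<i> \<cdot>\<^sub>m A + (-\<i>) \<cdot>\<^sub>m adj A"
    using Ac by (intro eq_matI) auto
  then have im: "\<i> \<cdot>\<^sub>m A + (-\<i>) \<cdot>\<^sub>m adj A = 0\<^sub>m n n"
    using hermitian_zero_if_extremal[OF X R ext] comb by blast
  show "A = 0\<^sub>m n n"
  proof (rule eq_matI)
    fix i j assume "i < dim_row (0\<^sub>m n n :: complex mat)" "j < dim_col (0\<^sub>m n n :: complex mat)"
    then have ij: "i < n" "j < n" by auto
    have "A $$ (i,j) + cnj (A $$ (j,i)) = 0" "\<i> * (A $$ (i,j) - cnj (A $$ (j,i))) = 0"
      using arg_cong[OF re, of "\<lambda>M. M $$ (i,j)"] arg_cong[OF im, of "\<lambda>M. M $$ (i,j)"] ij Ac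
      by (simp_all add: algebra_simps)
    then show "A $$ (i,j) = 0\<^sub>m n n $$ (i,j)" using ij by (auto simp: algebra_simps)
  qed (use Ac in auto)
qed

section \<open>Duality of injectivity and surjectivity\<close>

lemma mtrace_ptrace1_bop:
  assumes C: "C \<in> carrier_mat b b" and M: "block_family M"
  shows "mtrace (C * ptrace1 a b (bop M))
    = (\<Sum>k<N. mtrace (ptrace1 (d k) (m k) (adj (J k) * kron (1\<^sub>m a) C * J k) * M k))"
proof -
  have K: "kron (1\<^sub>m a) C \<in> carrier_mat n n" using C by (auto simp: n_eq)
  have S: "sandwich k (kron (1\<^sub>m (d k)) (M k)) \<in> carrier_mat n n" if "k < N" for k
    using M that by (intro sandwich_carrier kron_block_carrier) auto
  \<comment> \<open>First use of the duality of partial traces: the trace over K is moved onto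
    \<open>C\<close>.\<close>
  have "mtrace (C * ptrace1 a b (bop M)) = mtrace (kron (1\<^sub>m a) C * bop M)"
    using bop_carrier C by (intro mtrace_ptrace1) (simp_all add: n_eq)
  also have "\<dots> = mtrace (msum n N (\<lambda>k. kron (1\<^sub>m a) C * sandwich k (kron (1\<^sub>m (d k)) (M k))))"
    unfolding bop_eq using K S by (subst mult_msum) auto
  also have "\<dots> = (\<Sum>k<N. mtrace (kron (1\<^sub>m a) C * sandwich k (kron (1\<^sub>m (d k)) (M k))))"
    by (rule mtrace_msum) (rule mult_carrier_mat[OF K S])
  also have "\<dots> = (\<Sum>k<N. mtrace (ptrace1 (d k) (m k) (adj (J k) * kron (1\<^sub>m a) C * J k) * M k))"
  proof (intro sum.cong refl)
    fix k assume "k \<in> {..<N}"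
    then have k: "k < N" by simp
    let ?L = "kron (1\<^sub>m (d k)) (M k)" and ?B = "adj (J k) * kron (1\<^sub>m a) C * J k"
    have Mk: "M k \<in> carrier_mat (m k) (m k)" using M k by blast
    have L: "?L \<in> carrier_mat (d k * m k) (d k * m k)" using Mk by auto
    have JL: "J k * ?L \<in> carrier_mat n (d k * m k)" using J_carrier[OF k] L by (rule mult_carrier_mat)
    have KJL: "kron (1\<^sub>m a) C * (J k * ?L) \<in> carrier_mat n (d k * m k)" using K JL by (rule mult_carrier_mat)
    have B: "?B \<in> carrier_mat (d k * m k) (d k * m k)" using k by (intro carrier_matI) auto
    have Kd: "dim_row (kron (1\<^sub>m a) C) = n" "dim_col (kron (1\<^sub>m a) C) = n" using K by auto
    have "mtrace (kron (1\<^sub>m a) C * sandwich k ?L) = mtrace (kron (1\<^sub>m a) C * (J k * ?L) * adj (J k))"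
      using k Kd L by (simp add: mat_mult_assoc)
    also have "\<dots> = mtrace (adj (J k) * (kron (1\<^sub>m a) C * (J k * ?L)))"
      by (rule mtrace_comm[OF KJL adj_carrier[OF J_carrier[OF k]]])
    also have "adj (J k) * (kron (1\<^sub>m a) C * (J k * ?L)) = ?B * ?L"
      using k Kd L by (simp add: mat_mult_assoc)
    also have "mtrace (?B * ?L) = mtrace (?L * ?B)" by (rule mtrace_comm[OF B L])
    \<comment> \<open>Second use, in the opposite direction: the identity factor in block
      \<open>k\<close> becomes the trace over the irreducible space.\<close>
    also have "\<dots> = mtrace (M k * ptrace1 (d k) (m k) ?B)" by (rule mtrace_ptrace1[OF B Mk, symmetric])
    also have "\<dots> = mtrace (ptrace1 (d k) (m k) ?B * M k)" by (rule mtrace_comm[OF Mk ptrace1_carrier])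
    finally show "mtrace (kron (1\<^sub>m a) C * sandwich k ?L) = mtrace (ptrace1 (d k) (m k) ?B * M k)" .
  qed
  finally show ?thesis .
qed

lemma block_map_carrier:
  assumes "block_family X" "k < N"
  shows "block_map X C k \<in> carrier_mat (m k) (m k)"
  using assms by (intro carrier_matI) (auto simp: block_map_def)

text \<open>\<open>block_map X\<close> is dual to the map whose kernel occurs in \<open>injectivity X\<close>.\<close>

lemma block_map_duality:
  assumes X: "block_family X" and C: "C \<in> carrier_mat b b" and Y: "block_family Y"
  shows "mtrace (C * ptrace1 a b (adj (bop X) * bop Y * bop X)) = (\<Sum>k<N. mtrace (block_map X C k * Y k))"
proof -
  have X': "block_family (\<lambda>k. adj (X k))" using X by auto
  note XY = block_family_mult[OF X' Y]
  note XYX = block_family_mult[OF XY X]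
  have "adj (bop X) * bop Y * bop X = bop (\<lambda>k. adj (X k) * Y k * X k)"
    unfolding adj_bop[OF X] bop_mult[OF X' Y] bop_mult[OF XY X] ..
  then have "mtrace (C * ptrace1 a b (adj (bop X) * bop Y * bop X))
    = (\<Sum>k<N. mtrace (ptrace1 (d k) (m k) (adj (J k) * kron (1\<^sub>m a) C * J k) * (adj (X k) * Y k * X k)))"
    using mtrace_ptrace1_bop[OF C XYX] by simp
  also have "\<dots> = (\<Sum>k<N. mtrace (block_map X C k * Y k))"
  proof (intro sum.cong refl)
    fix k assume "k \<in> {..<N}"
    then have k: "X k \<in> carrier_mat (m k) (m k)" "Y k \<in> carrier_mat (m k) (m k)" using X Y by auto
    define B where "B = ptrace1 (d k) (m k) (adj (J k) * kron (1\<^sub>m a) C * J k)"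
    have B: "B \<in> carrier_mat (m k) (m k)" by (simp add: B_def)
    have U: "B * adj (X k) * Y k \<in> carrier_mat (m k) (m k)"
      using k B by (intro carrier_matI) auto
    have "mtrace (B * (adj (X k) * Y k * X k)) = mtrace (B * adj (X k) * Y k * X k)"
      using k B by (simp add: mat_mult_assoc)
    also have "\<dots> = mtrace (X k * (B * adj (X k) * Y k))" by (rule mtrace_comm[OF U k(1)])
    also have "X k * (B * adj (X k) * Y k) = block_map X C k * Y k"
      unfolding block_map_def B_def[symmetric] using k B by (simp add: mat_mult_assoc)
    finally show "mtrace (ptrace1 (d k) (m k) (adj (J k) * kron (1\<^sub>m a) C * J k) * (adj (X k) * Y k * X k))
        = mtrace (block_map X C k * Y k)" by (simp add: B_def)
  qed
  finally show ?thesis .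
qed

text \<open>Blocks with \<open>X k\<close> zero carry only the zero operator, so the surjectivity
  condition can leave them out.\<close>

lemma ops_on_rng_zero:
  assumes "A \<in> ops_on p (rng (0\<^sub>m p p))"
  shows "A = 0\<^sub>m p p"
proof -
  have "A \<in> carrier_mat p p" using assms by (simp add: ops_on_def)
  then show ?thesis using ops_on_rng_compress_zero[OF zero_carrier_mat assms] by simp
qed

text \<open>Choose \<open>C\<close> so that the blocks of its image are the adjoints of those of the
  kernel element. Duality then turns the vanishing partial trace into a vanishing sum of squared
  Hilbert-Schmidt norms.\<close>

lemma injectivity_if_surjectivity:
  assumes X: "block_family X" and surj: "surjectivity X"
  shows "injectivity X"
  unfolding injectivity_def
proof (intro allI impI)
  fix A assume A: "A \<in> commutant G n \<rho> \<and> A \<in> ops_on n (rng (bop X)) \<and>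
     ptrace1 a b (adj (bop X) * A * bop X) = 0\<^sub>m b b"
  obtain Y where Y: "block_family Y" "A = bop Y" using commutant_bop A by blast
  have Yops: "Y k \<in> ops_on (m k) (rng (X k))" if "k < N" for k
    using A bop_ops_on_iff[OF X Y(1)] that unfolding Y(2) by blast
  obtain C where C: "C \<in> carrier_mat b b"
    and CY: "\<And>k. k < N \<Longrightarrow> X k \<noteq> 0\<^sub>m (m k) (m k) \<Longrightarrow> adj (Y k) = block_map X C k"
    using surj[unfolded surjectivity_def, rule_format, of "\<lambda>k. adj (Y k)"] Yops ops_on_adj by auto
  \<comment> \<open>\<open>C\<close> is chosen for the blocks with \<open>X k\<close> nonzero only;
    in the others both sides vanish since \<open>Y k\<close> does.\<close>
  have trace_eq: "mtrace (block_map X C k * Y k) = mtrace (adj (Y k) * Y k)" if k: "k < N" for k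
  proof (cases "X k = 0\<^sub>m (m k) (m k)")
    case True
    then have "Y k = 0\<^sub>m (m k) (m k)" using Yops[OF k] by (auto intro: ops_on_rng_zero)
    then show ?thesis using block_map_carrier[OF X k, of C] by simp
  qed (use CY[OF k] in simp)
  have "(\<Sum>k<N. mtrace (adj (Y k) * Y k)) = mtrace (C * ptrace1 a b (adj (bop X) * bop Y * bop X))"
    unfolding block_map_duality[OF X C Y(1)] by (intro sum.cong) (simp_all add: trace_eq)
  also have "\<dots> = 0" using A C unfolding Y(2) by (simp add: mtrace_def)
  finally have "(\<Sum>k<N. mtrace (adj (Y k) * Y k)) = 0" .
  moreover define f where "f k = (\<Sum>j<m k. \<Sum>i<m k. (cmod (Y k $$ (i,j)))\<^sup>2)" for k
  have f: "mtrace (adj (Y k) * Y k) = of_real (f k)" if "k < N" for k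
    unfolding f_def using Y(1) that by (intro mtrace_adj_mult) auto
  ultimately have "complex_of_real (\<Sum>k<N. f k) = 0" by (simp add: f)
  then have "(\<Sum>k<N. f k) = 0" by (simp only: of_real_eq_0_iff)
  moreover have "f k \<ge> 0" for k unfolding f_def by (intro sum_nonneg) auto
  ultimately have "\<forall>k<N. f k = 0" by (simp add: sum_nonneg_eq_0_iff)
  then have "Y k = 0\<^sub>m (m k) (m k)" if "k < N" for k
    using mtrace_adj_mult_eq_0_iff[of "Y k" "m k" "m k"] f[OF that] Y(1) that by simp
  then have "bop Y = bop (\<lambda>k. 0\<^sub>m (m k) (m k))" by (rule bop_cong)
  then show "A = 0\<^sub>m n n" by (simp add: Y(2) bop_zero)
qed

text \<open>Puts the map into coordinates, the form that \<open>least_squares\<close> takes. The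
  coefficients are read off by duality against matrix units.\<close>

lemma block_map_index:
  assumes X: "block_family X"
  obtains \<Lambda> where "\<And>C k p q. C \<in> carrier_mat b b \<Longrightarrow> k < N \<Longrightarrow> p < m k \<Longrightarrow> q < m k \<Longrightarrow>
    block_map X C k $$ (p,q) = (\<Sum>(x,y)\<in>{..<b} \<times> {..<b}. C $$ (x,y) * \<Lambda> (x,y) (k,p,q))"
proof -
  \<comment> \<open>The matrix unit has its 1 at \<open>(q,p)\<close>, because the trace pairing
    then picks the entry \<open>(p,q)\<close> of block \<open>k\<close>. The swapped indices in
    \<open>\<Lambda>\<close> have the same origin.\<close>
  define U where "U k p q l = (mat (m l) (m l) (\<lambda>(i,j). if l = k \<and> i = q \<and> j = p then 1 else 0) :: complex mat)"
    for k p q l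
  have U: "block_family (U k p q)" for k p q by (simp add: U_def)
  define \<Psi> where "\<Psi> k p q = ptrace1 a b (adj (bop X) * bop (U k p q) * bop X)" for k p q
  define \<Lambda> where "\<Lambda> = (\<lambda>(x,y) (k,p,q). \<Psi> k p q $$ (y,x))"
  have "block_map X C k $$ (p,q) = (\<Sum>(x,y)\<in>{..<b} \<times> {..<b}. C $$ (x,y) * \<Lambda> (x,y) (k,p,q))"
    if C: "C \<in> carrier_mat b b" and k: "k < N" and p: "p < m k" and q: "q < m k" for C k p q
  proof -
    have "mtrace (block_map X C l * U k p q l) = (if l = k then block_map X C k $$ (p,q) else 0)"
      if l: "l < N" for l
    proof -
      have "mtrace (block_map X C l * U k p q l)
          = (\<Sum>i<m l. \<Sum>j<m l. block_map X C l $$ (i,j) * U k p q l $$ (j,i))"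
        using U l by (intro mtrace_mult block_map_carrier[OF X l]) auto
      also have "\<dots> = (\<Sum>i<m l. \<Sum>j<m l. if j = q then if i = p then
          if l = k then block_map X C k $$ (p,q) else 0 else 0 else 0)"
        by (intro sum.cong refl) (auto simp: U_def)
      also have "\<dots> = (if l = k then block_map X C k $$ (p,q) else 0)"
        using p q by (cases "l = k") simp_all
      finally show ?thesis .
    qed
    then have "(\<Sum>l<N. mtrace (block_map X C l * U k p q l))
        = (\<Sum>l<N. if l = k then block_map X C k $$ (p,q) else 0)"
      by (intro sum.cong) auto
    then have "block_map X C k $$ (p,q) = mtrace (C * \<Psi> k p q)"
      unfolding \<Psi>_def block_map_duality[OF X C U] using k by simp
    also have "\<dots> = (\<Sum>x<b. \<Sum>y<b. C $$ (x,y) * \<Psi> k p q $$ (y,x))"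
      using C by (intro mtrace_mult) (auto simp: \<Psi>_def)
    also have "\<dots> = (\<Sum>(x,y)\<in>{..<b} \<times> {..<b}. C $$ (x,y) * \<Lambda> (x,y) (k,p,q))"
      by (simp add: sum.cartesian_product \<Lambda>_def)
    finally show ?thesis .
  qed
  then show thesis by (rule that)
qed

text \<open>The least-squares residual \<open>E\<close> of \<open>Y\<close> against the range of \<open>block_map X\<close> yields, by duality,
  the element \<open>bop O\<close> with \<open>O k = E k\<^sup>\<dagger>\<close> to which injectivity applies.\<close>

lemma surjectivity_if_injectivity:
  assumes X: "block_family X" and inj: "injectivity X"
  shows "surjectivity X"
  unfolding surjectivity_def
proof (intro allI impI)
  define S where "S = {k. k < N \<and> X k \<noteq> 0\<^sub>m (m k) (m k)}"
  fix Y assume "\<forall>k\<in>{k. k < N \<and> X k \<noteq> 0\<^sub>m (m k) (m k)}. Y k \<in> ops_on (m k) (rng (X k))"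
  then have Y: "Y k \<in> ops_on (m k) (rng (X k))" if "k \<in> S" for k using that by (simp add: S_def)
  have S: "S \<subseteq> {..<N}" by (auto simp: S_def)
  have Xc: "X k \<in> carrier_mat (m k) (m k)" if "k \<in> S" for k using X S that by auto
  have Yc: "Y k \<in> carrier_mat (m k) (m k)" if "k \<in> S" for k using Y[OF that] by (simp add: ops_on_def)
  obtain \<Lambda> where \<Lambda>: "\<And>C k p q. C \<in> carrier_mat b b \<Longrightarrow> k < N \<Longrightarrow> p < m k \<Longrightarrow> q < m k \<Longrightarrow>
    block_map X C k $$ (p,q) = (\<Sum>(x,y)\<in>{..<b} \<times> {..<b}. C $$ (x,y) * \<Lambda> (x,y) (k,p,q))"
    using block_map_index[OF X] by blast
  \<comment> \<open>\<open>?J\<close> runs over the entries of \<open>C\<close> and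
    \<open>?I\<close> over the entries of all blocks in \<open>S\<close>.\<close>
  let ?J = "{..<b} \<times> {..<b}" and ?I = "SIGMA k:S. {..<m k} \<times> {..<m k}"
  obtain c where c: "\<forall>j\<in>?J. (\<Sum>i\<in>?I. cnj ((\<lambda>(k,p,q). Y k $$ (p,q)) i - (\<Sum>l\<in>?J. c l * \<Lambda> l i)) * \<Lambda> j i) = 0"
    using least_squares[where J = ?J and I = ?I and y = "\<lambda>(k,p,q). Y k $$ (p,q)" and L = \<Lambda>] by blast
  define C0 where "C0 = mat b b c"
  have C0: "C0 \<in> carrier_mat b b" by (simp add: C0_def)
  define E where "E k = Y k + (-1) \<cdot>\<^sub>m block_map X C0 k" for k
  have E: "E k \<in> carrier_mat (m k) (m k)" if "k \<in> S" for k
    using Yc[OF that] block_map_carrier[OF X, of k C0] S that by (auto simp: E_def)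
  have Eops: "E k \<in> ops_on (m k) (rng (X k))" if "k \<in> S" for k
    unfolding E_def block_map_def
    by (intro ops_on_rng_add[OF Xc[OF that]] ops_on_rng_smult[OF Xc[OF that]] Y[OF that]
        ops_on_rng_sandwich[OF Xc[OF that]] ptrace1_carrier)
  have orth: "(\<Sum>(k,p,q)\<in>?I. cnj (E k $$ (p,q)) * \<Lambda> j (k,p,q)) = 0" if j: "j \<in> ?J" for j
  proof -
    have "(\<Sum>(k,p,q)\<in>?I. cnj (E k $$ (p,q)) * \<Lambda> j (k,p,q))
        = (\<Sum>i\<in>?I. cnj ((\<lambda>(k,p,q). Y k $$ (p,q)) i - (\<Sum>l\<in>?J. c l * \<Lambda> l i)) * \<Lambda> j i)"
    proof (intro sum.cong refl)
      fix i assume "i \<in> ?I"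
      then obtain k p q where i: "i = (k,p,q)" and k: "k \<in> S" "k < N" and pq: "p < m k" "q < m k"
        using S by auto
      have "block_map X C0 k $$ (p,q) = (\<Sum>l\<in>?J. c l * \<Lambda> l (k,p,q))"
        unfolding \<Lambda>[OF C0 k(2) pq] by (intro sum.cong refl) (auto simp: C0_def)
      moreover have "E k $$ (p,q) = Y k $$ (p,q) - block_map X C0 k $$ (p,q)"
        using Yc[OF k(1)] block_map_carrier[OF X k(2), of C0] pq by (simp add: E_def)
      ultimately show "(case i of (k,p,q) \<Rightarrow> cnj (E k $$ (p,q)) * \<Lambda> j (k,p,q))
          = cnj ((\<lambda>(k,p,q). Y k $$ (p,q)) i - (\<Sum>l\<in>?J. c l * \<Lambda> l i)) * \<Lambda> j i"
        by (simp add: i)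
    qed
    then show ?thesis using c[rule_format, OF j] by (rule trans)
  qed
  \<comment> \<open>The adjoint turns the trace pairing with \<open>W k\<close> into the
    Hilbert-Schmidt inner product with \<open>E k\<close>. Zero blocks outside \<open>S\<close>
    complete the family without contributing to the sum.\<close>
  define W where "W k = (if k \<in> S then adj (E k) else 0\<^sub>m (m k) (m k))" for k
  have W: "block_family W" using E by (auto simp: W_def)
  have Wops: "W k \<in> ops_on (m k) (rng (X k))" if k: "k < N" for k
  proof (cases "k \<in> S")
    case True
    then show ?thesis using ops_on_adj[OF Eops[OF True]] by (simp add: W_def)
  next
    case False
    have "X k * 0\<^sub>m (m k) (m k) * adj (X k) \<in> ops_on (m k) (rng (X k))"
      using X k by (intro ops_on_rng_sandwich) auto
    moreover have "X k * 0\<^sub>m (m k) (m k) * adj (X k) = 0\<^sub>m (m k) (m k)"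
      using X[rule_format, OF k] by simp
    ultimately show ?thesis using False by (simp add: W_def)
  qed
  let ?F = "ptrace1 a b (adj (bop X) * bop W * bop X)"
  have dual: "mtrace (C * ?F) = 0" if C: "C \<in> carrier_mat b b" for C
  proof -
    have "mtrace (C * ?F) = (\<Sum>k<N. mtrace (block_map X C k * W k))"
      by (rule block_map_duality[OF X C W])
    also have "\<dots> = (\<Sum>k\<in>S. mtrace (block_map X C k * W k))"
    proof (rule sum.mono_neutral_right)
      show "\<forall>k\<in>{..<N} - S. mtrace (block_map X C k * W k) = 0"
      proof
        fix k assume k: "k \<in> {..<N} - S"
        then show "mtrace (block_map X C k * W k) = 0"
          using block_map_carrier[OF X, of k C] by (simp add: W_def mtrace_def)
      qed
    qed (use S in auto)
    also have "\<dots> = (\<Sum>k\<in>S. \<Sum>p<m k. \<Sum>q<m k. block_map X C k $$ (p,q) * cnj (E k $$ (p,q)))"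
    proof (intro sum.cong refl)
      fix k assume k: "k \<in> S"
      then have "mtrace (block_map X C k * W k)
          = (\<Sum>p<m k. \<Sum>q<m k. block_map X C k $$ (p,q) * W k $$ (q,p))"
        using W S by (intro mtrace_mult block_map_carrier[OF X]) auto
      also have "\<dots> = (\<Sum>p<m k. \<Sum>q<m k. block_map X C k $$ (p,q) * cnj (E k $$ (p,q)))"
        using k E[OF k] by (intro sum.cong refl) (simp add: W_def)
      finally show "mtrace (block_map X C k * W k)
          = (\<Sum>p<m k. \<Sum>q<m k. block_map X C k $$ (p,q) * cnj (E k $$ (p,q)))" .
    qed
    also have "\<dots> = (\<Sum>(k,p,q)\<in>?I. block_map X C k $$ (p,q) * cnj (E k $$ (p,q)))"
      using finite_subset[OF S] by (simp add: sum.cartesian_product sum.Sigma case_prod_unfold)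
    also have "\<dots> = (\<Sum>i\<in>?I. \<Sum>j\<in>?J. C $$ j * (case i of (k,p,q) \<Rightarrow> cnj (E k $$ (p,q)) * \<Lambda> j (k,p,q)))"
    proof (intro sum.cong refl)
      fix i assume "i \<in> ?I"
      then obtain k p q where i: "i = (k,p,q)" and k: "k < N" and pq: "p < m k" "q < m k"
        using S by auto
      show "(case i of (k,p,q) \<Rightarrow> block_map X C k $$ (p,q) * cnj (E k $$ (p,q)))
          = (\<Sum>j\<in>?J. C $$ j * (case i of (k,p,q) \<Rightarrow> cnj (E k $$ (p,q)) * \<Lambda> j (k,p,q)))"
        unfolding i prod.case \<Lambda>[OF C k pq] sum_distrib_right by (intro sum.cong) auto
    qed
    also have "\<dots> = (\<Sum>j\<in>?J. C $$ j * (\<Sum>(k,p,q)\<in>?I. cnj (E k $$ (p,q)) * \<Lambda> j (k,p,q)))"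
      unfolding sum_distrib_left by (rule sum.swap)
    also have "\<dots> = 0" by (intro sum.neutral ballI) (simp only: orth mult_zero_right)
    finally show ?thesis .
  qed
  \<comment> \<open>Testing \<open>dual\<close> with the adjoint of \<open>?F\<close> gives the
    squared Hilbert-Schmidt norm of \<open>?F\<close>.\<close>
  have "?F = 0\<^sub>m b b"
    using dual[of "adj ?F"] mtrace_adj_mult_eq_0_iff[of ?F b b] by auto
  moreover have "bop W \<in> ops_on n (rng (bop X))" using bop_ops_on_iff[OF X W] Wops by blast
  ultimately have "bop W = 0\<^sub>m n n" using inj bop_commutant[OF W] unfolding injectivity_def by blast
  then have W0: "W k = 0\<^sub>m (m k) (m k)" if "k < N" for k
    using bop_eq_iff[OF W, of "\<lambda>k. 0\<^sub>m (m k) (m k)"] that by (simp add: bop_zero)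
  have "Y k = block_map X C0 k" if k: "k \<in> S" for k
  proof -
    have kN: "k < N" using S k by auto
    have "adj (adj (E k)) = 0\<^sub>m (m k) (m k)" using W0[OF kN] k by (simp add: W_def)
    then have E0: "E k = 0\<^sub>m (m k) (m k)" by simp
    show ?thesis
    proof (rule eq_matI)
      fix i j assume "i < dim_row (block_map X C0 k)" "j < dim_col (block_map X C0 k)"
      then show "Y k $$ (i,j) = block_map X C0 k $$ (i,j)"
        using arg_cong[OF E0, of "\<lambda>M. M $$ (i,j)"] block_map_carrier[OF X kN, of C0] Yc[OF k]
        by (simp add: E_def)
    qed (use block_map_carrier[OF X kN, of C0] Yc[OF k] in auto)
  qed
  then show "\<exists>C\<in>carrier_mat b b. \<forall>k\<in>{k. k < N \<and> X k \<noteq> 0\<^sub>m (m k) (m k)}. Y k = block_map X C k"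
    using C0 by (auto simp: S_def)
qed

end

theorem theorem4:
  fixes G :: "('g, 'b) monoid_scheme"
    and U V :: "'g \<Rightarrow> complex mat"
    and dH dK N :: nat
    and d m :: "nat \<Rightarrow> nat"
    and \<pi> :: "nat \<Rightarrow> 'g \<Rightarrow> complex mat"
    and J :: "nat \<Rightarrow> complex mat"
    and K0 R :: "complex mat"
  assumes "group G"
    and "unitary_rep G dH U"
    and "unitary_rep G dK V"
    and "isotypic_decomp G (dK * dH) (\<lambda>g. kron (V g) (cconj (U g))) N d m \<pi> J"
    and "psd dH K0" and "psd dH (1\<^sub>m dH - K0)"
    and "R \<in> CK0 G dK dH V U K0"
  shows "(\<exists>Xs. (\<forall>k<N. Xs k \<in> carrier_mat (m k) (m k)) \<and>
             R = adj (blockop (dK * dH) N d J Xs) * blockop (dK * dH) N d J Xs) \<and>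
         (\<forall>Xs. (\<forall>k<N. Xs k \<in> carrier_mat (m k) (m k)) \<and>
             R = adj (blockop (dK * dH) N d J Xs) * blockop (dK * dH) N d J Xs \<longrightarrow>
           (let X = blockop (dK * dH) N d J Xs;
                S = {k. k < N \<and> Xs k \<noteq> 0\<^sub>m (m k) (m k)};
                inj_cond = (\<forall>Ob. Ob \<in> commutant G (dK * dH) (\<lambda>g. kron (V g) (cconj (U g))) \<and>
                                 Ob \<in> ops_on (dK * dH) (rng X) \<and>
                                 ptrace1 dK dH (adj X * Ob * X) = 0\<^sub>m dH dH \<longrightarrow>
                                 Ob = 0\<^sub>m (dK * dH) (dK * dH));
                surj_cond = (\<forall>Y. (\<forall>k\<in>S. Y k \<in> ops_on (m k) (rng (Xs k))) \<longrightarrow>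
                               (\<exists>C \<in> carrier_mat dH dH. \<forall>k\<in>S.
                                  Y k = Xs k * ptrace1 (d k) (m k)
                                          (adj (J k) * kron (1\<^sub>m dK) C * J k) * adj (Xs k)))
            in (extremal_in (CK0 G dK dH V U K0) R \<longleftrightarrow> inj_cond) \<and> (inj_cond \<longleftrightarrow> surj_cond)))"
proof -
  let ?\<rho> = "\<lambda>g. kron (V g) (cconj (U g))"
  interpret covariant_ops G "dK * dH" ?\<rho> N d m \<pi> J dK dH K0
  proof
    show "isotypic_decomp G (dK * dH) ?\<rho> N d m \<pi> J" by fact
    fix g assume "g \<in> carrier G"
    then have "U g \<in> carrier_mat dH dH" "V g \<in> carrier_mat dK dK"
      using assms(2,3) by (auto simp: unitary_rep_def unitary_mat_def)
    then show "?\<rho> g \<in> carrier_mat (dK * dH) (dK * dH)" by (auto simp: cconj_def)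
  qed simp
  have CK0: "CK0 G dK dH V U K0 = feasible" by (simp add: CK0_def feasible_def)
  then have R: "R \<in> feasible" using assms(7) by simp
  then have ex: "\<exists>Xs. block_family Xs \<and> R = adj (bop Xs) * bop Xs"
    by (intro psd_commutant_factor) (simp_all add: feasible_def)
  have eq: "(extremal_in feasible R \<longleftrightarrow> injectivity Xs) \<and> (injectivity Xs \<longleftrightarrow> surjectivity Xs)"
    if "block_family Xs" "R = adj (bop Xs) * bop Xs" for Xs
    using that R extremal_if_injectivity injectivity_if_extremal
      injectivity_if_surjectivity surjectivity_if_injectivity by blast
  show ?thesis
    using ex eq unfolding CK0 Let_def injectivity_def surjectivity_def block_map_def by blast
qed

end
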